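(* Let $d\ge 2$ and $N\ge 2$ be integers. For all $0\le p<1$ there exists $\alpha_0=\alpha_0(p,d,N)<1$ such that, for $\mathbb P_p$-almost all $\omega\in\Omega$, the fractal percolation set $E(\omega)\subset\mathbb R^d$ is purely $\alpha$-unrectifiable for all $\alpha\in(0,1]$ with $\alpha_0<\alpha\le 1$.
   Context: Fractal percolation model. Let $\mathbb N=\{0,1,2,\dots\}$. For $n\in\mathbb N$, let $\mathcal Q_n$ be the collection of closed grid cubes $\prod_{i=1}^d[(l_i-1)N^{-n},l_iN^{-n}]$, $l_i\in\{1,\dots,N^n\}$, of $[0,1]^d$. Let $\Omega=\{0,1\}^{\bigcup_{n\in\mathbb N}\mathcal Q_n}$ (equivalently, the set of $\{0,1\}$-labellings of the vertices of the rooted $N^d$-branching tree), equipped with the completion of the product measure $\mathbb P_p$ under which the coordinates $\omega(Q)$ are independent and each equals $1$ with probability $p$ and $0$ with probability $1-p$. A cube $Q\in\mathcal Q_n$ is chosen if $\omega(Q)=1$; let $\mathcal C_n(\omega)=\{Q\in\mathcal Q_n\mid\omega(Q)=1\}$ and $$E(\omega)=\bigcap_{n=0}^\infty\ \bigcup_{Q\in\mathcal C_n(\omega)}Q .$$ Hölder curves and unrectifiability. Let $I\subset\mathbb R$ denote a closed and bounded interval, and let $0<\alpha\le 1$. A curve $\gamma\colon I\to\mathbb R^d$ is $(H,\alpha)$-Hölder at $a\in I$ (with $H\ge 0$) if $|\gamma(a)-\gamma(b)|\le H|a-b|^\alpha$ for every $b\in I$. A curve $\gamma$ is $\alpha$-Hölder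 if for every $a\in I$ there is $H_a\ge 0$ such that $\gamma$ is $(H_a,\alpha)$-Hölder at $a$. A set $A\subset\mathbb R^d$ is purely $\alpha$-unrectifiable if $\mathcal H^{1/\alpha}(A\cap\gamma(I))=0$ for all $\alpha$-Hölder curves $\gamma\colon I\to\mathbb R^d$, where $\mathcal H^s$ is the $s$-dimensional Hausdorff measure. *)

theory Defs
  imports "HOL-Probability.Probability"
begin

definition grid_cubes :: "nat \<Rightarrow> nat \<Rightarrow> (real ^ 'd) set set" where
  "grid_cubes N n =
     {cbox (\<chi> i. (real (l i) - 1) / real N ^ n) (\<chi> i. real (l i) / real N ^ n) |
        l :: 'd \<Rightarrow> nat. \<forall>i. l i \<in> {1..N ^ n}}"

text \<open>
  The labels 0 and 1 are rendered as False and True. The coordinates are indexed by the cubes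
  themselves; for N at least 2 cubes of different levels have different side lengths, so every
  cube belongs to exactly one level.
\<close>

definition percolation_space :: "real \<Rightarrow> nat \<Rightarrow> ((real ^ 'd) set \<Rightarrow> bool) measure" where
  "percolation_space p N =
     completion (PiM (\<Union>n. grid_cubes N n) (\<lambda>Q. measure_pmf (bernoulli_pmf p)))"

definition chosen_cubes ::
  "nat \<Rightarrow> ((real ^ 'd) set \<Rightarrow> bool) \<Rightarrow> nat \<Rightarrow> (real ^ 'd) set set" where
  "chosen_cubes N \<omega> n = {Q \<in> grid_cubes N n. \<omega> Q}"

definition percolation_set :: "nat \<Rightarrow> ((real ^ 'd) set \<Rightarrow> bool) \<Rightarrow> (real ^ 'd) set" where
  "percolation_set N \<omega> = (\<Inter>n. \<Union>Q\<in>chosen_cubes N \<omega> n. Q)"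

text \<open>
  The Hausdorff measure is meant for exponents s > 0 and carries no normalising constant.
  Covering sets are required to be bounded because the library diameter is unspecified on unbounded sets;
  countable covers are sequences, with empty sets (of diameter 0) allowed.
\<close>

definition hausdorff_premeasure :: "real \<Rightarrow> real \<Rightarrow> 'a::metric_space set \<Rightarrow> ennreal" where
  "hausdorff_premeasure s \<delta> A =
     (INF U \<in> {U :: nat \<Rightarrow> 'a set. A \<subseteq> (\<Union>i. U i) \<and> (\<forall>i. bounded (U i) \<and> diameter (U i) \<le> \<delta>)}.
        \<Sum>i. ennreal (diameter (U i) powr s))"

definition hausdorff_measure :: "real \<Rightarrow> 'a::metric_space set \<Rightarrow> ennreal" where
  "hausdorff_measure s A = (SUP \<delta> \<in> {0<..}. hausdorff_premeasure s \<delta> A)"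

definition Hoelder_at :: "real \<Rightarrow> real \<Rightarrow> real set \<Rightarrow> (real \<Rightarrow> 'a::real_normed_vector) \<Rightarrow> real \<Rightarrow> bool" where
  "Hoelder_at H \<alpha> I \<gamma> a \<longleftrightarrow> (\<forall>b\<in>I. norm (\<gamma> a - \<gamma> b) \<le> H * \<bar>a - b\<bar> powr \<alpha>)"

text \<open>
  The constant may depend on the point. For positive exponents continuity on I follows.
\<close>

definition Hoelder_curve :: "real \<Rightarrow> real set \<Rightarrow> (real \<Rightarrow> 'a::real_normed_vector) \<Rightarrow> bool" where
  "Hoelder_curve \<alpha> I \<gamma> \<longleftrightarrow> (\<forall>a\<in>I. \<exists>H\<ge>0. Hoelder_at H \<alpha> I \<gamma> a)"

definition purely_unrectifiable :: "real \<Rightarrow> 'a::real_normed_vector set \<Rightarrow> bool" where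
  "purely_unrectifiable \<alpha> A \<longleftrightarrow>
     (\<forall>a b (\<gamma> :: real \<Rightarrow> 'a). a \<le> b \<longrightarrow> Hoelder_curve \<alpha> {a..b} \<gamma> \<longrightarrow>
        hausdorff_measure (1 / \<alpha>) (A \<inter> \<gamma> ` {a..b}) = 0)"

end

theory Submission
  imports Defs
begin

text \<open>
  Suppose a Hoelder curve of exponent \<alpha> close to 1 meets the percolation set in positive
  measure of dimension 1/\<alpha>. At almost every parameter of the intersection, two things hold at all
  small scales: the curve spreads about as far as its exponent permits, and every not too small
  parameter interval nearby hits the percolation set. Cut the curve at such a scale into chords whose
  image size shrinks by a factor L from one level to the next. A chord yields at least L chords of the
  next level, and at least L + 1 unless the curve stays near the whole segment spanned by the chord.
  Since the number of chords grows at most like L^(1/\<alpha>) per level, for \<alpha> near 1 some nested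
  chain of chords follows straight segments at more than half of its levels.

  A segment all of whose points are near the percolation set at the resolution of the next levels forces
  about R = L^(1/3) independent blocks of cubes to contain chosen cubes. This has probability
  exponentially small in R, which beats the polynomially many discretised segments and chains, and
  different levels are independent. By a first moment bound, almost surely no point has such chains
  near it at all small scales.
\<close>

section \<open>Null sets for the Hausdorff measure\<close>

text \<open>The threshold \<alpha>_0 may depend on p, d and N only, while the Hoelder constant and
  the amount of spreading vary with curve and point. So L is fixed first, and these constants are
  absorbed by the number 2q of levels in a chain: with at most q straight levels a chord needs room
  for (L (L+1))^q shortest chords, the Hoelder bound leaves room for a constant times
  L^(2q/\<alpha>), and large q decides as soon as L^(2/\<alpha>) < L (L+1), that is \<alpha> > 2 ln
  L / ln (L (L+1)).

  Curves are uncountably many, so the random statement mentions none: it forbids points x with a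
  suitable chain within C scales of x in each of the consecutive windows of 2q levels. Its
  parameters C, q, first level and cell of x are countable, and one null set serves all curves and
  all \<alpha>.

  The relation L = R^3 comes from the detour of a bent chord. With tolerance 1/R, which cubes of
  relative side 1/R resolve, the detour is longer by a proportion 1/R^2 only, and this must still
  amount to an extra chord of relative length 1/L after rounding: L/R^2 = R \<ge> 3
  suffices.\<close>

definition hausdorff_null :: "real \<Rightarrow> 'a::metric_space set \<Rightarrow> bool" where
  "hausdorff_null s A \<longleftrightarrow> (\<forall>\<epsilon>>0. \<exists>U :: nat \<Rightarrow> 'a set. A \<subseteq> (\<Union>i. U i) \<and> (\<forall>i. bounded (U i)) \<and>
     (\<Sum>i. ennreal (diameter (U i) powr s)) \<le> ennreal \<epsilon>)"

lemma ennreal_le_suminf: "(f :: nat \<Rightarrow> ennreal) i \<le> suminf f"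
proof -
  have "sum f {i} \<le> suminf f"
    by (intro sum_le_suminf summableI) auto
  then show ?thesis by simp
qed

text \<open>\<open>hausdorff_null\<close> puts no bound on the diameters. For s > 0 nothing is lost:
  a total of at most \<open>\<delta> powr s\<close> keeps every single diameter at most
  \<delta>.\<close>

lemma hausdorff_measure_eq_0I:
  assumes "s > 0" and null: "hausdorff_null s A"
  shows "hausdorff_measure s A = 0"
proof -
  have "hausdorff_premeasure s \<delta> A \<le> 0" if "\<delta> > 0" for \<delta>
  proof (rule ennreal_le_epsilon)
    fix e :: real
    assume "e > 0"
    define \<epsilon> where "\<epsilon> = min e (\<delta> powr s)"
    have "\<epsilon> > 0"
      using \<open>e > 0\<close> \<open>\<delta> > 0\<close> by (simp add: \<epsilon>_def)
    then obtain U where *: "A \<subseteq> (\<Union>i. U i) \<and> (\<forall>i. bounded (U i)) \<and>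
        (\<Sum>i. ennreal (diameter (U i) powr s)) \<le> ennreal \<epsilon>"
      using null unfolding hausdorff_null_def by presburger
    note U = *[THEN conjunct1] *[THEN conjunct2, THEN conjunct1, rule_format]
    note sum = *[THEN conjunct2, THEN conjunct2]
    have "diameter (U i) \<le> \<delta>" for i
    proof -
      have "ennreal (diameter (U i) powr s) \<le> (\<Sum>i. ennreal (diameter (U i) powr s))"
        by (rule ennreal_le_suminf)
      also note sum
      finally have "diameter (U i) powr s \<le> \<epsilon>"
        by (rule ennreal_le_iff[THEN iffD1, rotated]) (simp add: less_imp_le \<open>\<epsilon> > 0\<close>)
      then have "\<not> \<delta> powr s < diameter (U i) powr s"
        by (simp add: \<epsilon>_def)
      then show ?thesis
        using powr_less_mono2[OF \<open>s > 0\<close>, of \<delta> "diameter (U i)"] \<open>\<delta> > 0\<close> by force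
    qed
    then have "hausdorff_premeasure s \<delta> A \<le> (\<Sum>i. ennreal (diameter (U i) powr s))"
      unfolding hausdorff_premeasure_def using U by (intro INF_lower) auto
    also have "\<dots> \<le> ennreal e"
      using sum \<epsilon>_def by (metis dual_order.trans ennreal_leI min.cobounded1)
    finally show "hausdorff_premeasure s \<delta> A \<le> 0 + ennreal e" by simp
  qed
  then show ?thesis
    unfolding hausdorff_measure_def by (simp add: SUP_eq_const)
qed

lemma hausdorff_null_subset: "hausdorff_null s B \<Longrightarrow> A \<subseteq> B \<Longrightarrow> hausdorff_null s A"
  unfolding hausdorff_null_def by (meson subset_trans)

lemma hausdorff_null_UN:
  fixes A :: "nat \<Rightarrow> 'a::metric_space set"
  assumes "\<And>n. hausdorff_null s (A n)"
  shows "hausdorff_null s (\<Union>n. A n)"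
  unfolding hausdorff_null_def
proof (intro allI impI)
  fix \<epsilon> :: real
  assume "\<epsilon> > 0"
  have "\<forall>n. \<exists>U :: nat \<Rightarrow> 'a set. A n \<subseteq> (\<Union>i. U i) \<and> (\<forall>i. bounded (U i)) \<and>
     (\<Sum>i. ennreal (diameter (U i) powr s)) \<le> ennreal (\<epsilon> * (1/2) ^ Suc n)"
    using assms \<open>\<epsilon> > 0\<close> unfolding hausdorff_null_def by simp
  then obtain U where U: "\<And>n. A n \<subseteq> (\<Union>i. U n i)" "\<And>n i. bounded (U n i :: 'a set)"
    "\<And>n. (\<Sum>i. ennreal (diameter (U n i) powr s)) \<le> ennreal (\<epsilon> * (1/2) ^ Suc n)"
    by metis
  let ?V = "\<lambda>k. case prod_decode k of (n, i) \<Rightarrow> U n i"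
  have "(\<Sum>k. ennreal (diameter (?V k) powr s)) = (\<Sum>n. \<Sum>i. ennreal (diameter (U n i) powr s))"
    by (subst suminf_ennreal_2dimen[symmetric, where f = "\<lambda>(n, i). ennreal (diameter (U n i) powr s)"])
      (auto simp only: split_def fst_conv snd_conv)
  also have "\<dots> \<le> (\<Sum>n. ennreal (\<epsilon> * (1/2) ^ Suc n))"
    by (intro suminf_le U) auto
  also have "\<dots> = ennreal \<epsilon>"
    using sums_mult[OF power_half_series, of \<epsilon>] \<open>\<epsilon> > 0\<close>
    by (intro suminf_ennreal_eq) auto
  finally have "(\<Sum>k. ennreal (diameter (?V k) powr s)) \<le> ennreal \<epsilon>" .
  moreover have "(\<Union>n. A n) \<subseteq> (\<Union>k. ?V k)"
  proof
    fix x assume "x \<in> (\<Union>n. A n)"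
    then obtain n i where "x \<in> U n i" using U(1) by blast
    then have "x \<in> ?V (prod_encode (n, i))" by simp
    then show "x \<in> (\<Union>k. ?V k)" by (rule UN_I[OF UNIV_I])
  qed
  ultimately show "\<exists>V :: nat \<Rightarrow> 'a set. (\<Union>n. A n) \<subseteq> (\<Union>i. V i) \<and> (\<forall>i. bounded (V i)) \<and>
     (\<Sum>i. ennreal (diameter (V i) powr s)) \<le> ennreal \<epsilon>"
    using U(2) by (intro exI[of _ ?V] conjI allI) (simp_all add: split_def)
qed

lemma countable_cover_sequence:
  fixes V :: "'k \<Rightarrow> 'a::metric_space set"
  assumes "countable K" and "A \<subseteq> (\<Union>k\<in>K. V k)" and "\<And>k. k \<in> K \<Longrightarrow> bounded (V k)"
  shows "\<exists>U :: nat \<Rightarrow> 'a set. A \<subseteq> (\<Union>i. U i) \<and> (\<forall>i. bounded (U i)) \<and>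
    (\<Sum>i. ennreal (diameter (U i) powr s)) = (\<integral>\<^sup>+k. ennreal (diameter (V k) powr s) \<partial>count_space K)"
proof -
  let ?f = "to_nat_on K"
  \<comment> \<open>Indices outside the range are padded with the empty set, which adds
    \<open>0 powr s = 0\<close> to the sum.\<close>
  let ?U = "\<lambda>n. if n \<in> ?f ` K then V (from_nat_into K n) else {}"
  have inj: "bij_betw ?f K (?f ` K)"
    by (simp add: assms(1) inj_on_imp_bij_betw inj_on_to_nat_on)
  have "(\<Sum>i. ennreal (diameter (?U i) powr s)) = (\<integral>\<^sup>+n. ennreal (diameter (?U n) powr s) \<partial>count_space UNIV)"
    by (simp add: nn_integral_count_space_nat)
  also have "\<dots> = (\<integral>\<^sup>+n. ennreal (diameter (V (from_nat_into K n)) powr s) \<partial>count_space (?f ` K))"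
    by (subst nn_integral_count_space_indicator) (auto intro!: nn_integral_cong simp: indicator_def)
  also have "\<dots> = (\<integral>\<^sup>+k. ennreal (diameter (V (from_nat_into K (?f k))) powr s) \<partial>count_space K)"
    by (rule nn_integral_bij_count_space[OF inj, symmetric])
  also have "\<dots> = (\<integral>\<^sup>+k. ennreal (diameter (V k) powr s) \<partial>count_space K)"
    by (intro nn_integral_cong) (simp add: assms(1))
  finally have "(\<Sum>i. ennreal (diameter (?U i) powr s)) = (\<integral>\<^sup>+k. ennreal (diameter (V k) powr s) \<partial>count_space K)" .
  moreover have "A \<subseteq> (\<Union>i. ?U i)"
  proof
    fix x assume "x \<in> A"
    then obtain k where "k \<in> K" "x \<in> V k" using assms by blast
    then have "x \<in> ?U (?f k)" by (simp add: assms(1))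
    then show "x \<in> (\<Union>i. ?U i)" by (rule UN_I[OF UNIV_I])
  qed
  moreover have "bounded (?U i)" for i
    using assms by (auto intro!: assms(3))
  ultimately show ?thesis by (intro exI[of _ ?U] conjI allI)
qed

section \<open>Dyadic intervals on the parameter line\<close>

definition dyadic :: "nat \<Rightarrow> int \<Rightarrow> real set" where
  "dyadic j i = {of_int i / 2 ^ j..<(of_int i + 1) / 2 ^ j}"

lemma mem_dyadic_iff: "t \<in> dyadic j i \<longleftrightarrow> i = \<lfloor>t * 2 ^ j\<rfloor>"
  unfolding dyadic_def by (auto simp: field_simps floor_eq_iff) linarith+

lemma mem_dyadic_floor: "t \<in> dyadic j \<lfloor>t * 2 ^ j\<rfloor>"
  by (simp add: mem_dyadic_iff)

lemma dyadic_dist: "t \<in> dyadic j i \<Longrightarrow> t' \<in> dyadic j i \<Longrightarrow> \<bar>t - t'\<bar> \<le> 1 / 2 ^ j"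
  unfolding dyadic_def by (auto simp: field_simps abs_le_iff)

lemma emeasure_dyadic: "emeasure lborel (dyadic j i) = ennreal (1 / 2 ^ j)"
  unfolding dyadic_def by (subst emeasure_lborel_Ico) (auto simp: divide_right_mono add_divide_distrib)

lemma dyadic_sets [measurable]: "dyadic j i \<in> sets borel"
  unfolding dyadic_def by simp

lemma floor_dyadic_coarser: "\<lfloor>(t::real) * 2 ^ j\<rfloor> = \<lfloor>t * 2 ^ (j + p)\<rfloor> div 2 ^ p"
proof -
  have "\<lfloor>(t * 2 ^ (j + p)) / of_int (2 ^ p)\<rfloor> = \<lfloor>t * 2 ^ (j + p)\<rfloor> div 2 ^ p"
    by (rule floor_divide_real_eq_div) simp
  then show ?thesis by (simp add: power_add)
qed

lemma dyadic_nested: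
  assumes "j \<le> j'" and "t \<in> dyadic j i" and "t \<in> dyadic j' i'"
  shows "dyadic j' i' \<subseteq> dyadic j i"
proof
  fix x assume "x \<in> dyadic j' i'"
  moreover obtain p where p: "j' = j + p" using assms(1) le_Suc_ex by blast
  ultimately show "x \<in> dyadic j i"
    using assms(2,3) by (auto simp: mem_dyadic_iff floor_dyadic_coarser[of _ j p])
qed

text \<open>Dyadic intervals are nested or disjoint, so it suffices to keep the members of
  \<open>F\<close> that meet no member of a coarser level: the coarsest member around a point
  survives. This does the work of a covering theorem without losing a constant.\<close>

lemma dyadic_disjoint_subfamily:
  obtains F' where "F' \<subseteq> F" and "(\<Union>(j, i)\<in>F'. dyadic j i) = (\<Union>(j, i)\<in>F. dyadic j i)"
    and "disjoint_family_on (\<lambda>(j, i). dyadic j i) F'"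
proof
  let ?F' = "{(j, i) \<in> F. \<forall>j' i'. (j', i') \<in> F \<and> j' < j \<longrightarrow> dyadic j i \<inter> dyadic j' i' = {}}"
  show "?F' \<subseteq> F" by auto
  have "t \<in> (\<Union>(j, i)\<in>?F'. dyadic j i)" if ji: "(j, i) \<in> F" "t \<in> dyadic j i" for t j i
  proof -
    let ?P = "\<lambda>j. \<exists>i. (j, i) \<in> F \<and> t \<in> dyadic j i"
    let ?m = "LEAST j. ?P j"
    have "?P j" using ji by blast
    then have "?P ?m" by (rule LeastI)
    then obtain k where k: "(?m, k) \<in> F" "t \<in> dyadic ?m k" by blast
    have "dyadic ?m k \<inter> dyadic j' i' = {}" if "(j', i') \<in> F" "j' < ?m" for j' i'
    proof (rule ccontr)
      assume "dyadic ?m k \<inter> dyadic j' i' \<noteq> {}"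
      then obtain x where "x \<in> dyadic ?m k" "x \<in> dyadic j' i'" by blast
      then have "dyadic ?m k \<subseteq> dyadic j' i'"
        using that(2) dyadic_nested[of j' ?m x i' k] by simp
      then have "?P j'" using that k by blast
      then show False using not_less_Least that(2) by blast
    qed
    then show ?thesis using k by blast
  qed
  then have "(\<Union>(j, i)\<in>F. dyadic j i) \<subseteq> (\<Union>(j, i)\<in>?F'. dyadic j i)"
    by (intro UN_least subsetI) (auto simp only: split_paired_all prod.case)
  moreover have "(\<Union>(j, i)\<in>?F'. dyadic j i) \<subseteq> (\<Union>(j, i)\<in>F. dyadic j i)"
    by (rule UN_mono) auto
  ultimately show "(\<Union>(j, i)\<in>?F'. dyadic j i) = (\<Union>(j, i)\<in>F. dyadic j i)" by (rule equalityI[rotated])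
  have *: "dyadic j i \<inter> dyadic j' i' = {}" if "(j, i) \<in> ?F'" "(j', i') \<in> ?F'" "(j, i) \<noteq> (j', i')" for j i j' i'
  proof (cases j j' rule: linorder_cases)
    case equal
    then show ?thesis using that by (auto simp: mem_dyadic_iff)
  next
    case less then show ?thesis using that by blast
  next
    case greater then show ?thesis using that by blast
  qed
  show "disjoint_family_on (\<lambda>(j, i). dyadic j i) ?F'"
    unfolding disjoint_family_on_def split_paired_Ball_Sigma
    using * by (auto split: prod.splits)
qed

lemma emeasure_UN_dyadic:
  assumes "disjoint_family_on (\<lambda>(j, i). dyadic j i) F"
  shows "emeasure lborel (\<Union>(j, i)\<in>F. dyadic j i) = (\<integral>\<^sup>+(j, i). ennreal (1 / 2 ^ j) \<partial>count_space F)"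
proof -
  have "emeasure lborel (\<Union>(j, i)\<in>F. dyadic j i)
      = (\<integral>\<^sup>+k. emeasure lborel (case k of (j, i) \<Rightarrow> dyadic j i) \<partial>count_space F)"
    using assms by (intro emeasure_UN_countable) (auto split: prod.splits)
  also have "\<dots> = (\<integral>\<^sup>+(j, i). ennreal (1 / 2 ^ j) \<partial>count_space F)"
    by (intro nn_integral_cong) (auto simp: emeasure_dyadic)
  finally show ?thesis .
qed

lemma UN_dyadic_sets [measurable]: "(\<Union>(j, i)\<in>F. dyadic j i) \<in> sets borel"
  by (intro sets.countable_UN') (auto split: prod.splits)


text \<open>If each piece of the image costs at most C times the length of its parameter interval,
  Lebesgue measure controls Hausdorff content. \<open>F\<close> may overlap; on a disjoint subfamily
  the lengths add up to the measure of the union.\<close>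

lemma hausdorff_null_dyadic_coverI:
  fixes f :: "real \<Rightarrow> 'a::metric_space"
  assumes "\<And>\<epsilon>. \<epsilon> > 0 \<Longrightarrow> \<exists>F C. A \<subseteq> (\<Union>(j, i)\<in>F. dyadic j i) \<and> C \<ge> 0 \<and>
     (\<forall>(j, i)\<in>F. bounded (f ` (A \<inter> dyadic j i)) \<and> diameter (f ` (A \<inter> dyadic j i)) powr s \<le> C * (1 / 2 ^ j)) \<and>
     ennreal C * emeasure lborel (\<Union>(j, i)\<in>F. dyadic j i) \<le> ennreal \<epsilon>"
  shows "hausdorff_null s (f ` A)"
  unfolding hausdorff_null_def
proof (intro allI impI)
  fix \<epsilon> :: real
  assume "\<epsilon> > 0"
  then obtain F C where cover: "A \<subseteq> (\<Union>(j, i)\<in>F. dyadic j i)" and "C \<ge> 0"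
    and F: "\<forall>(j, i)\<in>F. bounded (f ` (A \<inter> dyadic j i)) \<and> diameter (f ` (A \<inter> dyadic j i)) powr s \<le> C * (1 / 2 ^ j)"
    and meas: "ennreal C * emeasure lborel (\<Union>(j, i)\<in>F. dyadic j i) \<le> ennreal \<epsilon>"
    using assms[OF \<open>\<epsilon> > 0\<close>] by (elim exE conjE) (rule that)
  obtain F' where F': "F' \<subseteq> F" "(\<Union>(j, i)\<in>F'. dyadic j i) = (\<Union>(j, i)\<in>F. dyadic j i)"
    and disj: "disjoint_family_on (\<lambda>(j, i). dyadic j i) F'"
    by (rule dyadic_disjoint_subfamily)
  let ?V = "\<lambda>(j, i). f ` (A \<inter> dyadic j i)"
  have "(\<integral>\<^sup>+k. ennreal (diameter (?V k) powr s) \<partial>count_space F')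
      \<le> (\<integral>\<^sup>+k. ennreal C * (case k of (j, i) \<Rightarrow> ennreal (1 / 2 ^ j)) \<partial>count_space F')"
    using F F'(1) \<open>C \<ge> 0\<close>
    by (intro nn_integral_mono) (auto simp flip: ennreal_mult split: prod.splits intro!: ennreal_leI)
  also have "\<dots> = ennreal C * emeasure lborel (\<Union>(j, i)\<in>F'. dyadic j i)"
    unfolding emeasure_UN_dyadic[OF disj] by (simp add: nn_integral_cmult)
  finally have "(\<integral>\<^sup>+k. ennreal (diameter (?V k) powr s) \<partial>count_space F') \<le> ennreal \<epsilon>"
    unfolding F'(2) using meas by (rule order.trans)
  moreover have "f ` A \<subseteq> (\<Union>k\<in>F'. ?V k)"
    using cover unfolding F'(2)[symmetric] by fastforce
  moreover have "bounded (?V k)" if "k \<in> F'" for k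
    using F F'(1) that by fastforce
  ultimately show "\<exists>U :: nat \<Rightarrow> 'a set. f ` A \<subseteq> (\<Union>i. U i) \<and> (\<forall>i. bounded (U i)) \<and>
     (\<Sum>i. ennreal (diameter (U i) powr s)) \<le> ennreal \<epsilon>"
    using countable_cover_sequence[of F' "f ` A" ?V s] by (metis countableI_type)
qed

section \<open>Porous sets of parameters\<close>

lemma lmeasurable_outer_open:
  fixes G :: "real set"
  assumes G: "G \<in> lmeasurable" and "\<eta> > 0"
  obtains T where "open T" "G \<subseteq> T" "T \<in> lmeasurable" "measure lebesgue T < measure lebesgue G + \<eta>"
proof -
  obtain T where T: "open T" "G \<subseteq> T" "T - G \<in> lmeasurable" "emeasure lebesgue (T - G) < ennreal \<eta>"
    using sets_lebesgue_outer_open[of G \<eta>] G \<open>\<eta> > 0\<close> by blast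
  have "G \<union> (T - G) \<in> lmeasurable"
    using G T(3) by (rule fmeasurable.Un)
  then have meas: "T \<in> lmeasurable"
    using T(2) by (simp add: Un_absorb1)
  have "measure lebesgue (T - G) = measure lebesgue T - measure lebesgue G"
    using T(2) G meas by (simp add: measurable_measure_Diff fmeasurableD)
  moreover have "measure lebesgue (T - G) < \<eta>"
    using T(3,4) \<open>\<eta> > 0\<close> by (simp add: emeasure_eq_measure2 ennreal_less_iff)
  ultimately show thesis
    using that T(1,2) meas by simp
qed

text \<open>The factor is gained on each interval of a disjoint family by discarding the subinterval that
  misses \<open>U\<close>; applied to nearly optimal open covers, it forces the outer measure of \<open>U\<close> to vanish.\<close>

lemma porous_outer_measure:
  assumes por: "\<And>t J. t \<in> U \<Longrightarrow> \<exists>j\<ge>J. \<exists>i. dyadic (j + p) i \<subseteq> dyadic j \<lfloor>t * 2 ^ j\<rfloor> \<and> dyadic (j + p) i \<inter> U = {}"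
    and G: "open G" "G \<in> lmeasurable" "U \<subseteq> G"
  shows "\<exists>G'\<in>lmeasurable. U \<subseteq> G' \<and> measure lebesgue G' \<le> (1 - 1 / 2 ^ p) * measure lebesgue G"
proof -
  define F where "F = {(j, i). dyadic j i \<subseteq> G \<and> (\<exists>i'. dyadic (j + p) i' \<subseteq> dyadic j i \<and> dyadic (j + p) i' \<inter> U = {})}"
  have "\<exists>(j, i)\<in>F. t \<in> dyadic j i" if "t \<in> U" for t
  proof -
    have "t \<in> G" using that G by blast
    then obtain e where "e > 0" "ball t e \<subseteq> G" using G(1) openE by blast
    obtain J where J: "(1/2) ^ J < e"
      using real_arch_pow_inv[OF \<open>e > 0\<close>, of "1/2"] by auto
    obtain j i where j: "j \<ge> J" "dyadic (j + p) i \<subseteq> dyadic j \<lfloor>t * 2 ^ j\<rfloor>" "dyadic (j + p) i \<inter> U = {}"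
      using por \<open>t \<in> U\<close> by blast
    have "dyadic j \<lfloor>t * 2 ^ j\<rfloor> \<subseteq> ball t e"
    proof
      fix x assume "x \<in> dyadic j \<lfloor>t * 2 ^ j\<rfloor>"
      then have "\<bar>t - x\<bar> \<le> 1 / 2 ^ j"
        using dyadic_dist mem_dyadic_floor by blast
      also have "\<dots> \<le> (1/2) ^ J"
        using j(1) by (simp add: power_divide field_simps power_increasing)
      finally show "x \<in> ball t e" using J by (simp add: dist_real_def)
    qed
    then have "(j, \<lfloor>t * 2 ^ j\<rfloor>) \<in> F"
      using j \<open>ball t e \<subseteq> G\<close> unfolding F_def by blast
    then show ?thesis using mem_dyadic_floor by blast
  qed
  then have cover: "U \<subseteq> (\<Union>(j, i)\<in>F. dyadic j i)" by blast
  obtain F' where F': "F' \<subseteq> F" "(\<Union>(j, i)\<in>F'. dyadic j i) = (\<Union>(j, i)\<in>F. dyadic j i)"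
    and disj: "disjoint_family_on (\<lambda>(j, i). dyadic j i) F'"
    by (rule dyadic_disjoint_subfamily)
  have "\<forall>k\<in>F'. \<exists>i'. dyadic (fst k + p) i' \<subseteq> dyadic (fst k) (snd k) \<and> dyadic (fst k + p) i' \<inter> U = {}"
    using F'(1) unfolding F_def by auto
  then obtain h where *: "\<forall>k\<in>F'. dyadic (fst k + p) (h k) \<subseteq> dyadic (fst k) (snd k) \<and> dyadic (fst k + p) (h k) \<inter> U = {}"
    by (rule bchoice[THEN exE])
  have h: "dyadic (j + p) (h (j, i)) \<subseteq> dyadic j i" "dyadic (j + p) (h (j, i)) \<inter> U = {}"
    if "(j, i) \<in> F'" for j i
    using *[rule_format, OF that] by simp_all
  define T where "T = (\<Union>(j, i)\<in>F'. dyadic j i)"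
  define H where "H = (\<Union>(j, i)\<in>F'. dyadic (j + p) (h (j, i)))"
  have [measurable]: "T \<in> sets borel" "H \<in> sets borel"
    unfolding T_def H_def by (auto intro!: sets.countable_UN' split: prod.splits)
  have "H \<subseteq> T"
    unfolding H_def T_def using h(1) by fast
  have "T \<subseteq> G"
    unfolding T_def using F'(1) unfolding F_def by fast
  have fin: "emeasure lborel T < \<infinity>"
  proof -
    have "emeasure lborel T \<le> emeasure lborel G"
      using \<open>T \<subseteq> G\<close> G(1) by (intro emeasure_mono) auto
    also have "\<dots> < \<infinity>"
      using G(1,2) unfolding fmeasurable_def by auto
    finally show ?thesis .
  qed
  have "emeasure lborel H = (\<integral>\<^sup>+(j, i). emeasure lborel (dyadic (j + p) (h (j, i))) \<partial>count_space F')"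
  proof -
    have "disjoint_family_on (\<lambda>(j, i). dyadic (j + p) (h (j, i))) F'"
      using disj h(1) unfolding disjoint_family_on_def by fast
    then have "emeasure lborel H = (\<integral>\<^sup>+k. emeasure lborel ((\<lambda>(j, i). dyadic (j + p) (h (j, i))) k) \<partial>count_space F')"
      unfolding H_def by (intro emeasure_UN_countable) (auto split: prod.splits)
    then show ?thesis by (simp add: split_def)
  qed
  also have "\<dots> = (\<integral>\<^sup>+k. ennreal (1 / 2 ^ p) * (case k of (j, i) \<Rightarrow> ennreal (1 / 2 ^ j)) \<partial>count_space F')"
    by (intro nn_integral_cong) (auto simp: emeasure_dyadic power_add simp flip: ennreal_mult split: prod.splits)
  also have "\<dots> = ennreal (1 / 2 ^ p) * emeasure lborel T"
    unfolding T_def emeasure_UN_dyadic[OF disj] by (simp add: nn_integral_cmult)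
  finally have "measure lborel H = 1 / 2 ^ p * measure lborel T"
    by (simp add: measure_def enn2real_mult)
  moreover have "measure lborel (T - H) = measure lborel T - measure lborel H"
    using fin \<open>H \<subseteq> T\<close> by (intro measure_Diff) auto
  ultimately have "measure lebesgue (T - H) = (1 - 1 / 2 ^ p) * measure lborel T"
    by (simp add: algebra_simps)
  also have "\<dots> \<le> (1 - 1 / 2 ^ p) * measure lebesgue G"
    using measure_mono_fmeasurable[OF \<open>T \<subseteq> G\<close> _ G(2)] by (intro mult_left_mono) auto
  finally have "measure lebesgue (T - H) \<le> (1 - 1 / 2 ^ p) * measure lebesgue G" .
  moreover have "U \<subseteq> T - H"
    using cover h(2) unfolding T_def H_def F'(2) by fast
  moreover have "T - H \<in> lmeasurable"
    by (rule fmeasurableI2[OF G(2)]) (use \<open>T \<subseteq> G\<close> in auto)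
  ultimately show ?thesis by blast
qed

text \<open>\<open>U\<close> is not assumed measurable, so the argument runs with its outer measure
  \<theta>. If \<theta> were positive, shrinking a nearly optimal open cover by the factor q < 1
  would produce a cover of measure below \<theta>.\<close>

lemma porous_negligible:
  assumes por: "\<And>t J. t \<in> U \<Longrightarrow> \<exists>j\<ge>J. \<exists>i. dyadic (j + p) i \<subseteq> dyadic j \<lfloor>t * 2 ^ j\<rfloor> \<and> dyadic (j + p) i \<inter> U = {}"
    and "bounded U"
  shows "negligible U"
proof (rule ccontr)
  assume neg: "\<not> negligible U"
  define S where "S = measure lebesgue ` {G \<in> lmeasurable. U \<subseteq> G}"
  define \<theta> where "\<theta> = Inf S"
  have bdd: "bdd_below S"
    unfolding S_def by (intro bdd_belowI[of _ 0]) auto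
  obtain a where "U \<subseteq> cball 0 a"
    using bounded_subset_ballD[OF \<open>bounded U\<close>, of 0] ball_subset_cball by blast
  then have "cball 0 a \<in> {G \<in> lmeasurable. U \<subseteq> G}"
    by simp
  then have "S \<noteq> {}"
    unfolding S_def by blast
  obtain e where "e > 0" and e: "\<And>T. T \<in> lmeasurable \<Longrightarrow> U \<subseteq> T \<Longrightarrow> e \<le> measure lebesgue T"
    using neg unfolding negligible_outer by (meson not_le)
  then have "\<theta> \<ge> e"
    unfolding \<theta>_def using \<open>S \<noteq> {}\<close> by (intro cInf_greatest) (auto simp: S_def)
  define q :: real where "q = 1 - 1 / 2 ^ p"
  have q: "0 \<le> q" "q < 1" unfolding q_def by auto
  \<comment> \<open>Two approximation errors of size \<eta> cost \<theta> (1 - q) / 2 together, half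
    of what the factor q gains.\<close>
  define \<eta> where "\<eta> = \<theta> * (1 - q) / 4"
  have "\<eta> > 0" using \<open>e > 0\<close> \<open>\<theta> \<ge> e\<close> q by (simp add: \<eta>_def)
  have "Inf S < \<theta> + \<eta>" using \<open>\<eta> > 0\<close> by (simp add: \<theta>_def)
  then obtain G where G: "G \<in> lmeasurable" "U \<subseteq> G" "measure lebesgue G < \<theta> + \<eta>"
    using cInf_less_iff[OF \<open>S \<noteq> {}\<close> bdd] unfolding S_def by auto
  obtain G1 where G1: "open G1" "G \<subseteq> G1" "G1 \<in> lmeasurable" "measure lebesgue G1 < measure lebesgue G + \<eta>"
    using lmeasurable_outer_open[OF G(1) \<open>\<eta> > 0\<close>] by blast
  obtain G2 where G2: "G2 \<in> lmeasurable" "U \<subseteq> G2" "measure lebesgue G2 \<le> q * measure lebesgue G1"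
    using porous_outer_measure[OF por G1(1,3)] G(2) G1(2) unfolding q_def by blast
  have "\<theta> \<le> measure lebesgue G2"
    unfolding \<theta>_def using G2 bdd by (intro cInf_lower) (auto simp: S_def)
  also have "\<dots> \<le> q * (\<theta> + 2 * \<eta>)"
    using G2(3) G1(4) G(3) q by (smt (verit) mult_left_mono)
  also have "\<dots> \<le> q * \<theta> + 2 * \<eta>"
    using q \<open>\<eta> > 0\<close> mult_right_mono[of q 1 "2 * \<eta>"] by (simp add: algebra_simps)
  also have "\<dots> < \<theta>"
    using \<open>e > 0\<close> \<open>\<theta> \<ge> e\<close> q unfolding \<eta>_def by (simp add: field_simps)
  finally show False by simp
qed

section \<open>Straight and bent chords\<close>

text \<open>The ball condition keeps the starting points of all finer chords inside {u..v} within
  \<rho> of \<open>g u\<close>; this is the step bound of \<open>bad_chain\<close>.\<close>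

definition first_chord :: "(real \<Rightarrow> 'a::real_normed_vector) \<Rightarrow> real \<Rightarrow> real \<Rightarrow> real \<Rightarrow> bool" where
  "first_chord g \<rho> u v \<longleftrightarrow> u \<le> v \<and> norm (g v - g u) = \<rho> \<and> (\<forall>w\<in>{u..v}. norm (g w - g u) \<le> \<rho>)"

text \<open>The least parameter at distance exactly \<rho> works: by the intermediate value theorem,
  a point outside the ball before it would be preceded by another such parameter.\<close>

lemma first_chord_exists:
  assumes cont: "continuous_on {u..v} g" and "u \<le> v" and "norm (g v - g u) \<ge> \<rho>" and "\<rho> \<ge> 0"
  obtains v' where "v' \<le> v" and "first_chord g \<rho> u v'"
proof -
  let ?f = "\<lambda>w. norm (g w - g u)"
  have contf: "continuous_on {u..v} ?f"
    by (intro continuous_intros cont)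
  have "\<exists>w\<ge>u. w \<le> v \<and> ?f w = \<rho>"
    using assms contf by (intro IVT') auto
  moreover have "compact {w \<in> {u..v}. ?f w = \<rho>}"
    using continuous_closed_preimage[OF contf closed_atLeastAtMost, of "{\<rho>}"]
    by (auto simp: compact_eq_bounded_closed vimage_def Int_def intro: bounded_subset[OF bounded_closed_interval[of u v]])
  ultimately obtain v' where v': "v' \<in> {u..v}" "?f v' = \<rho>"
    and least: "\<And>w. w \<in> {u..v} \<Longrightarrow> ?f w = \<rho> \<Longrightarrow> v' \<le> w"
    using compact_attains_inf[of "{w \<in> {u..v}. ?f w = \<rho>}"] by auto
  have "?f w \<le> \<rho>" if "w \<in> {u..v'}" for w
  proof (rule ccontr)
    assume "\<not> ?f w \<le> \<rho>"
    then have "\<exists>x\<ge>u. x \<le> w \<and> ?f x = \<rho>"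
      using that v' \<open>\<rho> \<ge> 0\<close> by (intro IVT' continuous_on_subset[OF contf]) auto
    then obtain x where "x \<in> {u..w}" "?f x = \<rho>" by auto
    then have "w = v'" using least[of x] that v' by auto
    then show False using v' \<open>\<not> ?f w \<le> \<rho>\<close> by simp
  qed
  then show thesis
    using that[of v'] v' unfolding first_chord_def by auto
qed

text \<open>Walk greedily: each chord of size \<rho> lowers the distance to \<open>g v\<close> by at
  most \<rho>, so M chords follow one another before v, and each takes parameter length at least
  l.\<close>

lemma chord_walk:
  assumes "continuous_on {u..v} g" and "u \<le> v" and "real M * \<rho> \<le> norm (g v - g u)" and "\<rho> > 0"
    and "\<And>u' v'. u \<le> u' \<Longrightarrow> v' \<le> v \<Longrightarrow> first_chord g \<rho> u' v' \<Longrightarrow> l \<le> v' - u'"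
  shows "real M * l \<le> v - u"
  using assms
proof (induction M arbitrary: u)
  case (Suc M)
  have "\<rho> \<le> real (Suc M) * \<rho>"
    using \<open>\<rho> > 0\<close> by simp
  then have "\<rho> \<le> norm (g v - g u)" "0 \<le> \<rho>"
    using Suc.prems(3,4) by linarith+
  then obtain w where w: "w \<le> v" "first_chord g \<rho> u w"
    using first_chord_exists[OF Suc.prems(1,2)] by blast
  then have uw: "u \<le> w" "norm (g w - g u) = \<rho>"
    by (auto simp: first_chord_def)
  have "real M * l \<le> v - w"
  proof (rule Suc.IH)
    show "continuous_on {w..v} g"
      by (rule continuous_on_subset[OF Suc.prems(1)]) (use uw in auto)
    have "norm (g v - g u) \<le> norm (g v - g w) + norm (g w - g u)"
      by (rule norm_triangle_sub[of "g v - g u" "g w - g u", simplified, THEN order.trans]) simp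
    then show "real M * \<rho> \<le> norm (g v - g w)"
      using Suc.prems(3) uw(2) by (simp add: algebra_simps)
    show "l \<le> v' - u'" if "w \<le> u'" "v' \<le> v" "first_chord g \<rho> u' v'" for u' v'
      using Suc.prems(5) that uw(1) by auto
  qed (use w Suc.prems in auto)
  moreover have "l \<le> w - u"
    using Suc.prems(5) w by simp
  ultimately show ?case by (simp add: algebra_simps)
qed auto

text \<open>The quantifiers run from the segment to the curve: the curve may wander off, but no part
  of the segment may be avoided. This is the direction that forces chosen cubes all along the
  segment.\<close>

definition straight :: "(real \<Rightarrow> 'a::real_normed_vector) \<Rightarrow> real \<Rightarrow> real \<Rightarrow> real \<Rightarrow> bool" where
  "straight g \<eta> u v \<longleftrightarrow>
     (\<forall>z\<in>closed_segment (g u) (g v). \<exists>w\<in>{u..v}. norm (g w - z) < \<eta> * norm (g v - g u))"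

text \<open>Let z be a point of the segment that the curve avoids. By the intermediate value theorem
  the curve crosses the hyperplane through z orthogonal to the chord, at some
  \<open>g w = z + n\<close> with n orthogonal to the chord and of norm at least \<eta> times its
  length. The way over \<open>g w\<close> is then long by Pythagoras.\<close>

lemma bent_detour:
  fixes g :: "real \<Rightarrow> 'a::real_inner"
  assumes cont: "continuous_on {u..v} g" and "u \<le> v" and "\<not> straight g \<eta> u v" and "0 \<le> \<eta>" "\<eta> \<le> 1"
  obtains w where "w \<in> {u..v}"
    and "(1 + \<eta>\<^sup>2) * norm (g v - g u) \<le> norm (g w - g u) + norm (g v - g w)"
proof -
  let ?e = "g v - g u"
  obtain z where z: "z \<in> closed_segment (g u) (g v)"
    and far: "\<And>w. w \<in> {u..v} \<Longrightarrow> \<eta> * norm ?e \<le> norm (g w - z)"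
    using assms(3) unfolding straight_def by (meson not_less)
  obtain t where t: "0 \<le> t" "t \<le> 1" "z = (1 - t) *\<^sub>R g u + t *\<^sub>R g v"
    using z unfolding in_segment by blast
  have zt: "z = g u + t *\<^sub>R ?e"
    using t(3) by (simp add: algebra_simps)
  let ?f = "\<lambda>w. (g w - g u) \<bullet> ?e"
  have "continuous_on {u..v} ?f"
    by (intro continuous_intros cont)
  moreover have "t * (?e \<bullet> ?e) \<le> ?e \<bullet> ?e"
    using t(2) mult_right_mono[of t 1 "?e \<bullet> ?e"] by simp
  ultimately have "\<exists>w\<ge>u. w \<le> v \<and> ?f w = t * (?e \<bullet> ?e)"
    using t(1) \<open>u \<le> v\<close> by (intro IVT') auto
  then obtain w where w: "w \<in> {u..v}" "?f w = t * (?e \<bullet> ?e)" by auto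
  define n where "n = g w - z"
  have orth: "n \<bullet> ?e = 0"
    using w(2) by (simp add: n_def zt inner_diff_left inner_add_left algebra_simps)
  \<comment> \<open>Reflecting the second leg turns the two legs into a path with displacement
    \<open>?e + 2 *\<^sub>R n\<close>, whose squared norm is that of the chord plus four times that
    of n.\<close>
  have reflect: "norm (a *\<^sub>R ?e - n) = norm (a *\<^sub>R ?e + n)" for a
    using orth by (simp add: norm_eq_sqrt_inner inner_simps inner_commute)
  have "norm (?e + 2 *\<^sub>R n) = norm ((t *\<^sub>R ?e + n) + ((1 - t) *\<^sub>R ?e + n))"
    by (simp add: algebra_simps scaleR_2)
  also have "\<dots> \<le> norm (t *\<^sub>R ?e + n) + norm ((1 - t) *\<^sub>R ?e + n)"
    by (rule norm_triangle_ineq)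
  also have "\<dots> = norm (t *\<^sub>R ?e + n) + norm ((1 - t) *\<^sub>R ?e - n)"
    by (simp add: reflect)
  also have "t *\<^sub>R ?e + n = g w - g u"
    by (simp add: n_def zt)
  also have "(1 - t) *\<^sub>R ?e - n = g v - g w"
    by (simp add: n_def zt algebra_simps)
  finally have detour: "norm (?e + 2 *\<^sub>R n) \<le> norm (g w - g u) + norm (g v - g w)" .
  have "((1 + \<eta>\<^sup>2) * norm ?e)\<^sup>2 \<le> (1 + 4 * \<eta>\<^sup>2) * (norm ?e)\<^sup>2"
  proof -
    have "\<eta>\<^sup>2 \<le> 1"
      using assms by (simp add: power_le_one)
    then have "\<eta>\<^sup>2 * \<eta>\<^sup>2 \<le> \<eta>\<^sup>2"
      by (rule mult_left_le) simp
    moreover have "(1 + \<eta>\<^sup>2)\<^sup>2 = 1 + 2 * \<eta>\<^sup>2 + \<eta>\<^sup>2 * \<eta>\<^sup>2"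
      unfolding power2_eq_square[of "1 + \<eta>\<^sup>2"] by (simp add: algebra_simps)
    moreover note zero_le_power2[of \<eta>]
    ultimately have "(1 + \<eta>\<^sup>2)\<^sup>2 \<le> 1 + 4 * \<eta>\<^sup>2"
      by linarith
    then show ?thesis
      by (simp add: power_mult_distrib mult_right_mono)
  qed
  also have "\<dots> = (norm ?e)\<^sup>2 + 4 * (\<eta> * norm ?e)\<^sup>2"
    by (simp add: algebra_simps power_mult_distrib)
  also have "\<dots> \<le> (norm ?e)\<^sup>2 + 4 * (norm n)\<^sup>2"
    using far[OF w(1)] assms(4) unfolding n_def by (intro add_left_mono mult_left_mono power_mono) auto
  also have "\<dots> = (norm (?e + 2 *\<^sub>R n))\<^sup>2"
    using orth by (simp add: power2_norm_eq_inner inner_simps inner_commute)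
  finally have "(1 + \<eta>\<^sup>2) * norm ?e \<le> norm (?e + 2 *\<^sub>R n)"
    by (rule power2_le_imp_le) simp
  then show thesis
    using that[OF w(1)] detour by simp
qed

text \<open>The detour over w is longer by L \<eta>^2 \<ge> 3 chords of size \<rho>. This pays for
  rounding down the number of chords on both legs and leaves one chord more than L.\<close>

lemma bent_walk:
  fixes g :: "real \<Rightarrow> 'a::real_inner"
  assumes cont: "continuous_on {u..v} g" and "u \<le> v" and "\<not> straight g \<eta> u v" and "0 \<le> \<eta>" "\<eta> \<le> 1"
    and "real L * \<eta>\<^sup>2 \<ge> 3" and \<rho>: "norm (g v - g u) = real L * \<rho>" "\<rho> > 0" and "0 \<le> l"
    and l: "\<And>u' v'. u \<le> u' \<Longrightarrow> v' \<le> v \<Longrightarrow> first_chord g \<rho> u' v' \<Longrightarrow> l \<le> v' - u'"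
  shows "real (L + 1) * l \<le> v - u"
proof -
  obtain w where w: "w \<in> {u..v}"
    and det: "(1 + \<eta>\<^sup>2) * norm (g v - g u) \<le> norm (g w - g u) + norm (g v - g w)"
    using bent_detour[OF assms(1-5)] .
  define A where "A = nat \<lfloor>norm (g w - g u) / \<rho>\<rfloor>"
  define B where "B = nat \<lfloor>norm (g v - g w) / \<rho>\<rfloor>"
  have A: "real A \<le> norm (g w - g u) / \<rho>" "norm (g w - g u) / \<rho> < real A + 1"
    unfolding A_def using \<rho>(2) by (auto simp: of_nat_nat)
  have B: "real B \<le> norm (g v - g w) / \<rho>" "norm (g v - g w) / \<rho> < real B + 1"
    unfolding B_def using \<rho>(2) by (auto simp: of_nat_nat)
  have "real L + 3 \<le> (1 + \<eta>\<^sup>2) * real L"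
    using assms(6) by (simp add: algebra_simps)
  also have "\<dots> \<le> norm (g w - g u) / \<rho> + norm (g v - g w) / \<rho>"
    using det \<rho> by (simp add: field_simps)
  also have "\<dots> < real A + real B + 2"
    using A B by simp
  finally have "L + 1 \<le> A + B" by linarith
  have A': "real A * \<rho> \<le> norm (g w - g u)" and B': "real B * \<rho> \<le> norm (g v - g w)"
    using A(1) B(1) \<rho>(2) by (simp_all add: pos_le_divide_eq)
  have "real A * l \<le> w - u"
    by (rule chord_walk[OF continuous_on_subset[OF cont] _ A' \<rho>(2) l]) (use w in auto)
  moreover have "real B * l \<le> v - w"
    by (rule chord_walk[OF continuous_on_subset[OF cont] _ B' \<rho>(2) l]) (use w in auto)
  moreover have "real (L + 1) * l \<le> real (A + B) * l"
    using \<open>L + 1 \<le> A + B\<close> \<open>0 \<le> l\<close> by (intro mult_right_mono) auto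
  ultimately show ?thesis by (simp add: algebra_simps)
qed

text \<open>A bad point may be passed without being counted, so b is only a lower bound for the number of
  bad points among the first h points of the chain.\<close>

fun bad_chain :: "(nat \<Rightarrow> real) \<Rightarrow> (nat \<Rightarrow> 'a::real_normed_vector \<Rightarrow> bool) \<Rightarrow> nat \<Rightarrow> nat \<Rightarrow> nat \<Rightarrow> 'a \<Rightarrow> bool" where
  "bad_chain r bad 0 b n y = (b = 0)"
| "bad_chain r bad (Suc h) b n y = (\<exists>y'. norm (y' - y) \<le> r n \<and>
     (bad_chain r bad h b (Suc n) y' \<or> bad n y \<and> b > 0 \<and> bad_chain r bad h (b - 1) (Suc n) y'))"

lemma bad_chain_zero: "(\<And>n. 0 \<le> r n) \<Longrightarrow> bad_chain r bad h 0 n y"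
  by (induction h arbitrary: n) (auto intro!: exI[of _ y])

lemma bad_chain_le: "bad_chain r bad h b n y \<Longrightarrow> b \<le> h"
  by (induction h arbitrary: b n y) fastforce+

text \<open>By contraposition this finds a chain with more than b straight chords in any chord interval that
  is too short to carry L^b (L+1)^(h-b) chords of length at least l. Lengths of parameter intervals
  replace the count of chords, so that no family of disjoint intervals has to be constructed.\<close>

lemma chord_length:
  fixes g :: "real \<Rightarrow> 'a::real_inner"
  assumes "continuous_on {u..v} g" and "first_chord g (r n) u v"
    and "\<And>n. r n > 0" and "\<And>n. real L * r (Suc n) = r n"
    and "0 \<le> \<eta>" "\<eta> \<le> 1" and "real L * \<eta>\<^sup>2 \<ge> 3" and "0 \<le> l"
    and "\<And>u' v'. u \<le> u' \<Longrightarrow> v' \<le> v \<Longrightarrow> first_chord g (r (n + h)) u' v' \<Longrightarrow> l \<le> v' - u'"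
    and "\<And>i u' v'. i < h \<Longrightarrow> u \<le> u' \<Longrightarrow> v' \<le> v \<Longrightarrow> first_chord g (r (n + i)) u' v' \<Longrightarrow>
           straight g \<eta> u' v' \<Longrightarrow> bad (n + i) (g u')"
    and "b \<le> h" and "\<not> bad_chain r bad h (Suc b) n (g u)"
  shows "real (L ^ b * (L + 1) ^ (h - b)) * l \<le> v - u"
  using assms
proof (induction h arbitrary: u v n b)
  case 0
  then show ?case by simp
next
  case (Suc h)
  note prems = Suc.prems
  have uv: "u \<le> v" "norm (g v - g u) = real L * r (Suc n)" "\<And>w. w \<in> {u..v} \<Longrightarrow> norm (g w - g u) \<le> r n"
    using prems(2) unfolding first_chord_def prems(4) by auto
  have sub: "real (L ^ b' * (L + 1) ^ (h - b')) * l \<le> v' - u'"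
    if "u \<le> u'" "v' \<le> v" "first_chord g (r (Suc n)) u' v'" "b' \<le> h"
      "\<not> bad_chain r bad h (Suc b') (Suc n) (g u')" for b' u' v'
  proof (rule Suc.IH)
    show "continuous_on {u'..v'} g"
      using prems(1) by (rule continuous_on_subset) (use that in auto)
    show "l \<le> v'' - u''" if "u' \<le> u''" "v'' \<le> v'" "first_chord g (r (Suc n + h)) u'' v''" for u'' v''
      using prems(9)[of u'' v''] that \<open>u \<le> u'\<close> \<open>v' \<le> v\<close> by simp
    show "bad (Suc n + i) (g u'')" if "i < h" "u' \<le> u''" "v'' \<le> v'"
      "first_chord g (r (Suc n + i)) u'' v''" "straight g \<eta> u'' v''" for i u'' v''
      using prems(10)[of "Suc i" u'' v''] that \<open>u \<le> u'\<close> \<open>v' \<le> v\<close> by simp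
  qed (use that prems in auto)
  have near: "norm (g u' - g u) \<le> r n" if "u \<le> u'" "v' \<le> v" "first_chord g (r (Suc n)) u' v'" for u' v'
    using uv(3)[of u'] that by (auto simp: first_chord_def)
  have step: "\<not> bad_chain r bad h (Suc b) (Suc n) (g u')" "bad n (g u) \<Longrightarrow> \<not> bad_chain r bad h b (Suc n) (g u')"
    if "u \<le> u'" "v' \<le> v" "first_chord g (r (Suc n)) u' v'" for u' v'
    using prems(12) near[OF that] by auto
  have walk: "real L * l' \<le> v - u"
    if "\<And>u' v'. u \<le> u' \<Longrightarrow> v' \<le> v \<Longrightarrow> first_chord g (r (Suc n)) u' v' \<Longrightarrow> l' \<le> v' - u'" for l'
    by (rule chord_walk[OF prems(1) uv(1) _ prems(3)]) (use that uv(2) in auto)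
  show ?case
  proof (cases "straight g \<eta> u v")
    case True
    \<comment> \<open>A straight chord gives only \<open>L\<close> subchords, but its starting point
      counts as bad, so one unit of \<open>b\<close> is spent.\<close>
    then have "bad n (g u)"
      using prems(10)[of 0 u v] prems(2) by simp
    \<comment> \<open>For b = 0 the bad starting point, followed by a chain with count 0 from the
      first subchord, would already be an excluded chain.\<close>
    have "b \<noteq> 0"
    proof
      assume "b = 0"
      have "L \<noteq> 0"
        using prems(3)[of n] prems(4)[of n] by (metis less_irrefl mult_zero_left of_nat_0)
      then have "r (Suc n) \<le> real L * r (Suc n)"
        using prems(3)[of "Suc n"] mult_right_mono[of 1 "real L" "r (Suc n)"] by simp
      then have "r (Suc n) \<le> norm (g v - g u)" "0 \<le> r (Suc n)"
        using uv(2) prems(3)[of "Suc n"] by simp_all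
      then obtain v' where "v' \<le> v" "first_chord g (r (Suc n)) u v'"
        using first_chord_exists[OF prems(1) uv(1)] by blast
      then show False
        using step(2)[of u v'] \<open>bad n (g u)\<close> \<open>b = 0\<close> bad_chain_zero[of r bad h "Suc n" "g u"] prems(3)
        by (simp add: less_imp_le)
    qed
    then obtain b' where b': "b = Suc b'" by (cases b) auto
    have "real L * (real (L ^ b' * (L + 1) ^ (h - b')) * l) \<le> v - u"
      by (rule walk) (use sub[where b' = b'] step(2) \<open>bad n (g u)\<close> b' prems(11) in auto)
    then show ?thesis by (simp add: b' mult.assoc)
  next
    case False
    show ?thesis
    proof (cases "b \<le> h")
      case True
      have "real (L + 1) * (real (L ^ b * (L + 1) ^ (h - b)) * l) \<le> v - u"
        by (rule bent_walk[OF prems(1) uv(1) False prems(5,6,7) uv(2) prems(3)])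
          (use sub[where b' = b] step(1) True prems(8) in auto)
      then show ?thesis
        using True by (simp add: Suc_diff_le algebra_simps)
    next
      case False
      \<comment> \<open>Only h levels remain below this chord, so no chain can exceed the count, and
        \<open>L\<close> subchords are enough even though the chord is bent.\<close>
      then have b: "b = Suc h" using prems(11) by simp
      have "\<not> bad_chain r bad h (Suc h) (Suc n) y" for y
        using bad_chain_le[of r bad h "Suc h" "Suc n" y] by auto
      then have "real L * (real (L ^ h * (L + 1) ^ (h - h)) * l) \<le> v - u"
        by (intro walk) (use sub[where b' = h] in auto)
      then show ?thesis by (simp add: b mult.assoc)
    qed
  qed
qed

section \<open>Slow and porous parameter sets\<close>

text \<open>The tolerance is 2 \<eta> because two errors of size \<eta> add up: the segment is near
  the curve by straightness, and the curve is near \<open>E\<close> because good parameters are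
  dense.\<close>

definition flat_near :: "(nat \<Rightarrow> real) \<Rightarrow> real \<Rightarrow> 'a::real_normed_vector set \<Rightarrow> nat \<Rightarrow> 'a \<Rightarrow> bool" where
  "flat_near r \<eta> E n y \<longleftrightarrow> (\<exists>z. norm (z - y) = r n \<and> (\<forall>p\<in>closed_segment y z. \<exists>e\<in>E. norm (p - e) \<le> 2 * \<eta> * r n))"

text \<open>As \<open>B\<close> meets all subintervals p levels down, every parameter of the
  interval is \<epsilon>-close to \<open>B\<close>, and the Hoelder bound of \<open>B\<close> holds
  nearly everywhere. So a chord of the smallest size r' takes parameter length at least l. If every
  chain had at most q flat points, the chord of size \<open>r n\<close> that \<open>spread\<close>
  provides would need length (L (L+1))^q l, more than the interval has.\<close>

lemma bad_chain_at_scale: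
  fixes g :: "real \<Rightarrow> 'a::real_inner"
  defines "D \<equiv> \<lambda>j t. dyadic j \<lfloor>t * 2 ^ j\<rfloor>"
  assumes \<alpha>: "0 < \<alpha>" "\<alpha> \<le> 1" and cont: "continuous_on UNIV g"
    and hol: "\<And>t x. t \<in> B \<Longrightarrow> norm (g t - g x) \<le> h * \<bar>t - x\<bar> powr \<alpha>"
    and BE: "\<And>t. t \<in> B \<Longrightarrow> g t \<in> E" and pos: "h > 0" "c > 0"
    and r: "\<And>n. r n > 0" "\<And>n. real L * r (Suc n) = r n" and L: "L \<ge> 1"
    and \<eta>: "0 < \<eta>" "\<eta> \<le> 1" "real L * \<eta>\<^sup>2 \<ge> 3"
    and q: "4 * (2 * h * real L ^ (2 * q) / c) powr (1 / \<alpha>) \<le> real (L * (L + 1)) ^ q"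
    and p: "4 * (1 / 2 ^ p) \<le> (c * \<eta> / (2 * h * real L ^ (2 * q))) powr (1 / \<alpha>)"
    and t: "t \<in> B"
    and lucky: "\<And>i. dyadic (j + p) i \<subseteq> D j t \<Longrightarrow> dyadic (j + p) i \<inter> B \<noteq> {}"
    and spread: "\<exists>u\<in>D j t. \<exists>v\<in>D j t. norm (g u - g v) \<ge> c * (1 / 2 ^ j) powr \<alpha>"
    and j: "r n \<le> c * (1 / 2 ^ j) powr \<alpha>" "c * (1 / 2 ^ Suc j) powr \<alpha> < r n"
  shows "\<exists>y. norm (y - g t) \<le> 2 * h / c * r n \<and> bad_chain r (flat_near r \<eta> E) (2 * q) (Suc q) n y"
proof -
  define s where "s = 1 / \<alpha>"
  have s: "s > 0" "s \<ge> 1" "\<And>x. 0 \<le> x \<Longrightarrow> (x powr \<alpha>) powr s = x" "\<And>x. 0 \<le> x \<Longrightarrow> (x powr s) powr \<alpha> = x"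
    using \<alpha> by (simp_all add: s_def powr_powr)
  define r' where "r' = r (n + 2 * q)"
  have r_add: "real L ^ i * r (k + i) = r k" for i k
    by (induction i) (simp_all add: mult.assoc r(2) mult.left_commute[of "real L"])
  have r'_eq: "r n = real L ^ (2 * q) * r'"
    using r_add[of "2 * q" n] by (simp add: r'_def)
  have Lpos: "real L ^ i > 0" for i using L by simp
  have "r' > 0" by (simp add: r'_def r(1))
  have r_ge: "r' \<le> r (n + i)" if "i \<le> 2 * q" for i
  proof -
    have "1 * r' \<le> real L ^ (2 * q - i) * r'"
      using L \<open>r' > 0\<close> by (intro mult_right_mono one_le_power) auto
    then show ?thesis
      using r_add[of "2 * q - i" "n + i"] that by (simp add: r'_def)
  qed
  have small: "1 / 2 ^ j < 2 * (r n / c) powr s"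
  proof -
    have "(1 / 2 ^ Suc j) powr \<alpha> < r n / c"
      using j(2) pos by (simp add: pos_less_divide_eq mult.commute)
    then have "((1 / 2 ^ Suc j) powr \<alpha>) powr s < (r n / c) powr s"
      using s(1) by (intro powr_less_mono2) auto
    then have "1 / 2 ^ Suc j < (r n / c) powr s"
      by (subst (asm) s(3)) simp_all
    then show ?thesis by simp
  qed
  define \<epsilon> :: real where "\<epsilon> = 1 / 2 ^ (j + p)"
  have "\<epsilon> > 0" by (simp add: \<epsilon>_def)
  \<comment> \<open>The bound serves twice. Moving a parameter by \<epsilon> to a point of
    \<open>B\<close> moves the image by at most \<eta> r', and \<epsilon> is at most half of the
    parameter length (r' / (2 h))^s, which leaves the other half for l.\<close>
  have \<epsilon>: "\<epsilon> \<le> 1 / 2 * (\<eta> * r' / (2 * h)) powr s"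
  proof -
    have "\<epsilon> = 1 / 2 ^ j * (1 / 2 ^ p)" by (simp add: \<epsilon>_def power_add)
    also have "\<dots> \<le> (2 * (r n / c) powr s) * (1 / 4 * (c * \<eta> / (2 * h * real L ^ (2 * q))) powr s)"
      using small p unfolding s_def[symmetric] by (intro mult_mono) auto
    also have "\<dots> = 1 / 2 * ((r n / c) * (c * \<eta> / (2 * h * real L ^ (2 * q)))) powr s"
      using pos \<eta> r(1)[of n] by (subst powr_mult) auto
    also have "(r n / c) * (c * \<eta> / (2 * h * real L ^ (2 * q))) = \<eta> * r' / (2 * h)"
      using pos L by (simp add: r'_eq)
    finally show ?thesis .
  qed
  have close: "\<exists>b\<in>B. \<bar>w - b\<bar> \<le> \<epsilon>" if "w \<in> D j t" for w
  proof -
    have "dyadic (j + p) \<lfloor>w * 2 ^ (j + p)\<rfloor> \<subseteq> D j t"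
      unfolding D_def by (rule dyadic_nested[of _ _ w]) (use that mem_dyadic_floor in \<open>auto simp: D_def\<close>)
    then obtain b where "b \<in> B" "b \<in> dyadic (j + p) \<lfloor>w * 2 ^ (j + p)\<rfloor>"
      using lucky by blast
    then show ?thesis
      using dyadic_dist[OF mem_dyadic_floor] unfolding \<epsilon>_def by blast
  qed
  have eps_close: "h * \<epsilon> powr \<alpha> \<le> \<eta> * r'"
  proof -
    have "\<epsilon> \<le> (\<eta> * r' / (2 * h)) powr s"
      using \<epsilon> powr_ge_zero[of "\<eta> * r' / (2 * h)" s] by linarith
    then have "\<epsilon> powr \<alpha> \<le> ((\<eta> * r' / (2 * h)) powr s) powr \<alpha>"
      using \<alpha> \<open>\<epsilon> > 0\<close> by (intro powr_mono2) auto
    also have "\<dots> = \<eta> * r' / (2 * h)"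
      using \<eta> \<open>r' > 0\<close> pos by (intro s(4)) simp
    finally have "h * \<epsilon> powr \<alpha> \<le> h * (\<eta> * r' / (2 * h))"
      using pos by (intro mult_left_mono) auto
    also have "\<dots> \<le> \<eta> * r'" using pos \<eta> \<open>r' > 0\<close> by simp
    finally show ?thesis .
  qed
  \<comment> \<open>The 2 h arises because both end points of a chord are compared with one point of
    \<open>B\<close> near its start; the factor 1/2 absorbs \<epsilon>.\<close>
  define l where "l = 1 / 2 * (r' / (2 * h)) powr s"
  have chord: "l \<le> v' - u'" if "u' \<in> D j t" "first_chord g r' u' v'" for u' v'
  proof -
    obtain b where b: "b \<in> B" "\<bar>u' - b\<bar> \<le> \<epsilon>" using close \<open>u' \<in> D j t\<close> by blast
    have uv: "u' \<le> v'" "norm (g v' - g u') = r'" using that(2) by (auto simp: first_chord_def)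
    have hb: "norm (g b - g x) \<le> h * (v' - u' + \<epsilon>) powr \<alpha>" if "\<bar>b - x\<bar> \<le> v' - u' + \<epsilon>" for x
      using hol[OF b(1), of x] powr_mono2[of \<alpha> "\<bar>b - x\<bar>" "v' - u' + \<epsilon>"] that \<alpha> pos
      by (meson abs_ge_zero less_imp_le mult_left_mono order.trans)
    have "r' \<le> norm (g b - g v') + norm (g b - g u')"
      using uv(2) norm_triangle_ineq4[of "g b - g u'" "g b - g v'"] by simp
    also have "\<dots> \<le> 2 * (h * (v' - u' + \<epsilon>) powr \<alpha>)"
      using hb[of u'] hb[of v'] b(2) uv(1) by linarith
    finally have "r' / (2 * h) \<le> (v' - u' + \<epsilon>) powr \<alpha>"
      using pos by (simp add: pos_divide_le_eq mult_ac)
    then have "(r' / (2 * h)) powr s \<le> ((v' - u' + \<epsilon>) powr \<alpha>) powr s"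
      using \<open>r' > 0\<close> pos s by (intro powr_mono2) auto
    also have "\<dots> = v' - u' + \<epsilon>" using uv(1) \<open>\<epsilon> > 0\<close> by (intro s(3)) simp
    finally have "(r' / (2 * h)) powr s \<le> v' - u' + \<epsilon>" .
    moreover have "(\<eta> * r' / (2 * h)) powr s \<le> (r' / (2 * h)) powr s"
      using \<eta> \<open>r' > 0\<close> pos s by (intro powr_mono2 divide_right_mono) auto
    ultimately show ?thesis using \<epsilon> unfolding l_def by linarith
  qed
  obtain u0 v0 where uv0: "u0 \<in> D j t" "v0 \<in> D j t" "norm (g u0 - g v0) \<ge> c * (1 / 2 ^ j) powr \<alpha>" "u0 \<le> v0"
    using spread by (metis linear norm_minus_commute)
  have conv: "x \<in> D j t" if "u0 \<le> x" "x \<le> v0" for x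
    using uv0(1,2) that unfolding D_def dyadic_def by auto
  have "r n \<le> norm (g v0 - g u0)"
    using uv0(3) j(1) by (simp add: norm_minus_commute)
  then obtain v where v: "v \<le> v0" "first_chord g (r n) u0 v"
    using first_chord_exists[OF continuous_on_subset[OF cont] uv0(4)] r(1)[of n] by (metis less_imp_le subset_UNIV)
  have "u0 \<le> v" using v(2) by (simp add: first_chord_def)
  have "bad_chain r (flat_near r \<eta> E) (2 * q) (Suc q) n (g u0)"
  proof (rule ccontr)
    assume no: "\<not> bad_chain r (flat_near r \<eta> E) (2 * q) (Suc q) n (g u0)"
    have "real (L ^ q * (L + 1) ^ (2 * q - q)) * l \<le> v - u0"
    proof (rule chord_length[OF continuous_on_subset[OF cont subset_UNIV] v(2) r(1) r(2) _ \<eta>(2,3) _ _ _ _ no])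
      show "0 \<le> \<eta>" "0 \<le> l" "q \<le> 2 * q" using \<eta> by (simp_all add: l_def)
      show "l \<le> v' - u'" if "u0 \<le> u'" "v' \<le> v" "first_chord g (r (n + 2 * q)) u' v'" for u' v'
      proof (rule chord)
        show "first_chord g r' u' v'" using that(3) by (simp add: r'_def)
        then have "u' \<le> v'" by (simp add: first_chord_def)
        then show "u' \<in> D j t" using conv that v(1) by simp
      qed
      show "flat_near r \<eta> E (n + i) (g u')"
        if i: "i < 2 * q" and uv': "u0 \<le> u'" "v' \<le> v" and fc: "first_chord g (r (n + i)) u' v'" and st: "straight g \<eta> u' v'"
        for i u' v'
        unfolding flat_near_def
      proof (intro exI[of _ "g v'"] conjI ballI)
        show nv: "norm (g v' - g u') = r (n + i)" using fc by (simp add: first_chord_def)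
        fix z assume "z \<in> closed_segment (g u') (g v')"
        then obtain w where w: "w \<in> {u'..v'}" "norm (g w - z) < \<eta> * r (n + i)"
          using st unfolding straight_def nv by blast
        then have "w \<in> D j t" using conv uv' v(1) by auto
        then obtain b where b: "b \<in> B" "\<bar>w - b\<bar> \<le> \<epsilon>" using close by blast
        have "norm (g b - g w) \<le> h * \<bar>b - w\<bar> powr \<alpha>" by (rule hol[OF b(1)])
        also have "\<dots> \<le> h * \<epsilon> powr \<alpha>"
          using b(2) \<alpha> pos by (intro mult_left_mono powr_mono2) auto
        also have "\<dots> \<le> \<eta> * r (n + i)"
          using eps_close mult_left_mono[OF r_ge[of i], of \<eta>] i \<eta> by linarith
        finally have "norm (g b - g w) \<le> \<eta> * r (n + i)" .
        moreover have "norm (z - g b) \<le> norm (g w - z) + norm (g b - g w)"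
          using norm_triangle_ineq[of "g w - z" "g b - g w"] by (simp add: norm_minus_commute)
        ultimately have "norm (z - g b) \<le> 2 * \<eta> * r (n + i)" using w(2) by linarith
        then show "\<exists>e\<in>E. norm (z - e) \<le> 2 * \<eta> * r (n + i)" using BE[OF b(1)] by blast
      qed
    qed
    also have "v - u0 \<le> 1 / 2 ^ j"
    proof -
      have "v \<in> D j t" using conv \<open>u0 \<le> v\<close> v(1) by simp
      then have "\<bar>v - u0\<bar> \<le> 1 / 2 ^ j" unfolding D_def using uv0(1) dyadic_dist D_def by metis
      then show ?thesis by simp
    qed
    also note small
    finally have "real (L ^ q * (L + 1) ^ (2 * q - q)) * l < 2 * (r n / c) powr s" .
    moreover have "real (L ^ q * (L + 1) ^ (2 * q - q)) = real (L * (L + 1)) ^ q"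
      by (simp only: mult_2 add_diff_cancel_right' of_nat_mult of_nat_power power_mult_distrib)
    \<comment> \<open>This is where the hypothesis \<open>q\<close> comes from: measured in units of
      l, the interval is shorter than the left side of \<open>q\<close>.\<close>
    moreover have "2 * (r n / c) powr s = 4 * (2 * h * real L ^ (2 * q) / c) powr s * l"
    proof -
      have "r n / c = (2 * h * real L ^ (2 * q) / c) * (r' / (2 * h))"
        using pos by (simp add: r'_eq)
      also have "\<dots> powr s = (2 * h * real L ^ (2 * q) / c) powr s * (2 * l)"
        using pos \<open>r' > 0\<close> by (subst powr_mult) (simp_all add: l_def)
      finally show ?thesis by simp
    qed
    ultimately have "real (L * (L + 1)) ^ q * l < 4 * (2 * h * real L ^ (2 * q) / c) powr s * l"
      by metis
    moreover have "l > 0" using \<open>r' > 0\<close> pos by (simp add: l_def)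
    ultimately show False using q unfolding s_def[symmetric] by simp
  qed
  moreover have "norm (g u0 - g t) \<le> 2 * h / c * r n"
  proof -
    have "norm (g t - g u0) \<le> h * \<bar>t - u0\<bar> powr \<alpha>" by (rule hol[OF t])
    also have "\<dots> \<le> h * (1 / 2 ^ j) powr \<alpha>"
    proof -
      have "\<bar>t - u0\<bar> \<le> 1 / 2 ^ j"
        using dyadic_dist[OF mem_dyadic_floor] uv0(1) unfolding D_def by blast
      then show ?thesis using pos \<alpha> by (intro mult_left_mono powr_mono2) auto
    qed
    also have "(1 / 2 ^ j) powr \<alpha> = 2 powr \<alpha> * (1 / 2 ^ Suc j) powr \<alpha>"
      by (subst powr_mult[symmetric]) auto
    also have "h * (2 powr \<alpha> * (1 / 2 ^ Suc j) powr \<alpha>) \<le> h * (2 * (r n / c))"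
    proof -
      have "2 powr \<alpha> \<le> 2 powr 1" using \<alpha> by (intro powr_mono) auto
      moreover have "(1 / 2 ^ Suc j) powr \<alpha> \<le> r n / c"
        using j(2) pos by (simp add: pos_le_divide_eq mult.commute)
      ultimately show ?thesis using pos by (intro mult_left_mono mult_mono) auto
    qed
    finally show ?thesis by (simp add: norm_minus_commute mult_ac)
  qed
  ultimately show ?thesis by blast
qed


lemma exists_dyadic_scale:
  fixes c \<alpha> :: real
  assumes "0 < \<alpha>" "0 < c" "0 < \<rho>" "\<rho> \<le> c * (1 / 2 ^ J) powr \<alpha>"
  obtains j where "j \<ge> J" "\<rho> \<le> c * (1 / 2 ^ j) powr \<alpha>" "c * (1 / 2 ^ Suc j) powr \<alpha> < \<rho>"
proof -
  have "(\<lambda>j. (1 / 2 :: real) ^ j) \<longlonglongrightarrow> 0"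
    by (intro LIMSEQ_power_zero) simp
  then have "(\<lambda>j. c * ((1 / 2) ^ j) powr \<alpha>) \<longlonglongrightarrow> c * 0 powr \<alpha>"
    using assms(1) by (intro tendsto_intros tendsto_powr2) auto
  then have "eventually (\<lambda>j. c * ((1 / 2) ^ j) powr \<alpha> < \<rho>) sequentially"
    using assms(3) by (intro order_tendstoD(2)) auto
  then have ex: "\<exists>j. c * (1 / 2 ^ j) powr \<alpha> < \<rho>"
    unfolding eventually_sequentially by (auto simp: power_one_over)
  define k where "k = (LEAST j. c * (1 / 2 ^ j) powr \<alpha> < \<rho>)"
  have k: "c * (1 / 2 ^ k) powr \<alpha> < \<rho>"
    unfolding k_def by (rule LeastI_ex[OF ex])
  have "J < k"
  proof (rule ccontr)
    assume "\<not> J < k"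
    then have "(1 / 2 ^ J :: real) \<le> 1 / 2 ^ k"
      by (simp add: frac_le power_increasing)
    then have "c * (1 / 2 ^ J) powr \<alpha> \<le> c * (1 / 2 ^ k) powr \<alpha>"
      using assms by (intro mult_left_mono powr_mono2) auto
    then show False using k assms(4) by linarith
  qed
  then obtain j where j: "k = Suc j" "j \<ge> J" by (cases k) auto
  have "\<not> c * (1 / 2 ^ j) powr \<alpha> < \<rho>"
    using not_less_Least[of j "\<lambda>j. c * (1 / 2 ^ j) powr \<alpha> < \<rho>"] j(1) unfolding k_def by simp
  then show thesis using that[of j] j k by simp
qed

section \<open>Null images of negligible and of slow parameter sets\<close>

lemma diameter_image_powr_le:
  fixes f :: "real \<Rightarrow> 'a::real_normed_vector"
  assumes "0 < \<alpha>" "0 \<le> C"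
    and "\<And>u v. u \<in> S \<Longrightarrow> v \<in> S \<Longrightarrow> norm (f u - f v) \<le> C * (1 / 2 ^ j) powr \<alpha>"
  shows "bounded (f ` S) \<and> diameter (f ` S) powr (1 / \<alpha>) \<le> C powr (1 / \<alpha>) * (1 / 2 ^ j)"
proof
  let ?d = "C * (1 / 2 ^ j) powr \<alpha>"
  show "bounded (f ` S)"
    unfolding bounded_two_points using assms(3) by (intro exI[of _ ?d]) (auto simp: dist_norm)
  have "diameter (f ` S) \<le> ?d"
  proof (cases "f ` S = {}")
    case True
    then show ?thesis using assms(2) by simp
  next
    case False
    then show ?thesis using assms(3) by (intro diameter_le) auto
  qed
  then have "diameter (f ` S) powr (1 / \<alpha>) \<le> ?d powr (1 / \<alpha>)"
    using assms(1) \<open>bounded (f ` S)\<close> by (intro powr_mono2 diameter_ge_0) auto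
  also have "\<dots> = C powr (1 / \<alpha>) * (1 / 2 ^ j)"
    using assms(1,2) by (simp add: powr_mult powr_powr)
  finally show "diameter (f ` S) powr (1 / \<alpha>) \<le> C powr (1 / \<alpha>) * (1 / 2 ^ j)" .
qed

text \<open>The exponent 1/\<alpha> turns the Hoelder bound into one that is linear in the length.
  The dyadic intervals inside an open superset of small measure therefore give a cheap cover of the
  image.\<close>

lemma hausdorff_null_image_negligible:
  fixes f :: "real \<Rightarrow> 'a::real_normed_vector"
  assumes "0 < \<alpha>" "0 < h" and hol: "\<And>t x. t \<in> B \<Longrightarrow> norm (f t - f x) \<le> h * \<bar>t - x\<bar> powr \<alpha>"
    and "negligible B"
  shows "hausdorff_null (1 / \<alpha>) (f ` B)"
proof (rule hausdorff_null_dyadic_coverI)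
  fix \<epsilon> :: real
  assume "\<epsilon> > 0"
  define C where "C = h powr (1 / \<alpha>)"
  have "C > 0" using assms by (simp add: C_def)
  obtain T where T: "B \<subseteq> T" "T \<in> lmeasurable" "measure lebesgue T < \<epsilon> / C / 2"
    using \<open>negligible B\<close> \<open>\<epsilon> > 0\<close> \<open>C > 0\<close> unfolding negligible_outer by (meson divide_pos_pos zero_less_numeral)
  obtain G where G: "open G" "T \<subseteq> G" "G \<in> lmeasurable" "measure lebesgue G < measure lebesgue T + \<epsilon> / C / 2"
    using lmeasurable_outer_open[OF T(2), of "\<epsilon> / C / 2"] \<open>\<epsilon> > 0\<close> \<open>C > 0\<close> by auto
  define F where "F = {(j, i). dyadic j i \<subseteq> G}"
  have "\<exists>(j, i)\<in>F. t \<in> dyadic j i" if "t \<in> B" for t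
  proof -
    have "t \<in> G" using that T(1) G(2) by blast
    then obtain e where "e > 0" "ball t e \<subseteq> G" using G(1) openE by blast
    obtain j where j: "(1/2) ^ j < e"
      using real_arch_pow_inv[OF \<open>e > 0\<close>, of "1/2"] by auto
    have "dyadic j \<lfloor>t * 2 ^ j\<rfloor> \<subseteq> ball t e"
    proof
      fix x assume "x \<in> dyadic j \<lfloor>t * 2 ^ j\<rfloor>"
      then have "\<bar>t - x\<bar> \<le> 1 / 2 ^ j"
        using dyadic_dist mem_dyadic_floor by blast
      then show "x \<in> ball t e" using j by (simp add: dist_real_def power_one_over)
    qed
    then have "(j, \<lfloor>t * 2 ^ j\<rfloor>) \<in> F"
      using \<open>ball t e \<subseteq> G\<close> unfolding F_def by blast
    then show ?thesis using mem_dyadic_floor by blast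
  qed
  then have cover: "B \<subseteq> (\<Union>(j, i)\<in>F. dyadic j i)" by blast
  have "(\<Union>(j, i)\<in>F. dyadic j i) \<subseteq> G" unfolding F_def by fast
  then have "emeasure lborel (\<Union>(j, i)\<in>F. dyadic j i) \<le> emeasure lborel G"
    using G(1) by (intro emeasure_mono) auto
  also have "\<dots> = emeasure lebesgue G" using G(1) by simp
  also have "\<dots> = ennreal (measure lebesgue G)"
    using G(3) by (rule emeasure_eq_measure2)
  also have "\<dots> \<le> ennreal (\<epsilon> / C)" using T(3) G(4) by (intro ennreal_leI) simp
  finally have "ennreal C * emeasure lborel (\<Union>(j, i)\<in>F. dyadic j i) \<le> ennreal C * ennreal (\<epsilon> / C)"
    by (rule mult_left_mono) simp
  also have "\<dots> = ennreal \<epsilon>"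
    using \<open>C > 0\<close> \<open>\<epsilon> > 0\<close> by (simp flip: ennreal_mult)
  finally have meas: "ennreal C * emeasure lborel (\<Union>(j, i)\<in>F. dyadic j i) \<le> ennreal \<epsilon>" .
  have small: "bounded (f ` (B \<inter> dyadic j i)) \<and> diameter (f ` (B \<inter> dyadic j i)) powr (1 / \<alpha>) \<le> C * (1 / 2 ^ j)" for j i
    unfolding C_def
  proof (rule diameter_image_powr_le)
    fix u v assume uv: "u \<in> B \<inter> dyadic j i" "v \<in> B \<inter> dyadic j i"
    then have "norm (f u - f v) \<le> h * \<bar>u - v\<bar> powr \<alpha>" using hol by blast
    also have "\<dots> \<le> h * (1 / 2 ^ j) powr \<alpha>"
      using assms(1,2) dyadic_dist[of u j i v] uv by (intro mult_left_mono powr_mono2) auto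
    finally show "norm (f u - f v) \<le> h * (1 / 2 ^ j) powr \<alpha>" .
  qed (use assms in auto)
  show "\<exists>F C. B \<subseteq> (\<Union>(j, i)\<in>F. dyadic j i) \<and> C \<ge> 0 \<and>
     (\<forall>(j, i)\<in>F. bounded (f ` (B \<inter> dyadic j i)) \<and> diameter (f ` (B \<inter> dyadic j i)) powr (1 / \<alpha>) \<le> C * (1 / 2 ^ j)) \<and>
     ennreal C * emeasure lborel (\<Union>(j, i)\<in>F. dyadic j i) \<le> ennreal \<epsilon>"
    using cover meas small \<open>C > 0\<close> by (intro exI[of _ F] exI[of _ C] conjI) auto
qed

text \<open>\<open>Z\<close> may have positive measure; its image is null because each point has a
  scale at which the image is smaller by a factor 1/(k+1) than the exponent permits. Disjoint
  intervals of such scales have bounded total length, so the cost is of order (k+1)^(-1/\<alpha>),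
  and k is free.\<close>

lemma hausdorff_null_slow:
  fixes f :: "real \<Rightarrow> 'a::real_normed_vector"
  assumes "0 < \<alpha>" "Z \<subseteq> {a..b}" "a \<le> b"
    and slow: "\<And>t k. t \<in> Z \<Longrightarrow> \<exists>j. \<forall>u\<in>dyadic j \<lfloor>t * 2 ^ j\<rfloor>. \<forall>v\<in>dyadic j \<lfloor>t * 2 ^ j\<rfloor>.
        norm (f u - f v) \<le> 1 / real (Suc k) * (1 / 2 ^ j) powr \<alpha>"
  shows "hausdorff_null (1 / \<alpha>) (f ` Z)"
proof (rule hausdorff_null_dyadic_coverI)
  fix \<epsilon> :: real
  assume "\<epsilon> > 0"
  \<comment> \<open>Dyadic intervals have length at most 1, so those that meet [a,b] lie in
    [a-1,b+1].\<close>
  define m where "m = b - a + 2"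
  have "m > 0" using assms by (simp add: m_def)
  have "(\<lambda>k. (1 / real (Suc k)) powr (1 / \<alpha>)) \<longlonglongrightarrow> 0 powr (1 / \<alpha>)"
    using assms(1) LIMSEQ_inverse_real_of_nat
    by (intro tendsto_powr2) (auto simp: inverse_eq_divide intro: tendsto_const)
  then have "eventually (\<lambda>k. (1 / real (Suc k)) powr (1 / \<alpha>) < \<epsilon> / m) sequentially"
    using \<open>\<epsilon> > 0\<close> \<open>m > 0\<close> by (intro order_tendstoD(2)) auto
  then obtain k where k: "(1 / real (Suc k)) powr (1 / \<alpha>) < \<epsilon> / m"
    unfolding eventually_sequentially by blast
  define C where "C = (1 / real (Suc k)) powr (1 / \<alpha>)"
  define F where "F = {(j, i). (\<exists>t\<in>{a..b}. t \<in> dyadic j i) \<and> (\<forall>u\<in>dyadic j i. \<forall>v\<in>dyadic j i.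
        norm (f u - f v) \<le> 1 / real (Suc k) * (1 / 2 ^ j) powr \<alpha>)}"
  have cover: "Z \<subseteq> (\<Union>(j, i)\<in>F. dyadic j i)"
  proof
    fix t assume "t \<in> Z"
    then obtain j where "\<forall>u\<in>dyadic j \<lfloor>t * 2 ^ j\<rfloor>. \<forall>v\<in>dyadic j \<lfloor>t * 2 ^ j\<rfloor>.
        norm (f u - f v) \<le> 1 / real (Suc k) * (1 / 2 ^ j) powr \<alpha>"
      using slow by blast
    then have "(j, \<lfloor>t * 2 ^ j\<rfloor>) \<in> F"
      using \<open>t \<in> Z\<close> assms(2) mem_dyadic_floor unfolding F_def by blast
    then show "t \<in> (\<Union>(j, i)\<in>F. dyadic j i)"
      using mem_dyadic_floor by blast
  qed
  have sub: "(\<Union>(j, i)\<in>F. dyadic j i) \<subseteq> {a - 1..b + 1}"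
  proof
    fix x assume "x \<in> (\<Union>(j, i)\<in>F. dyadic j i)"
    then obtain j i t where t: "t \<in> {a..b}" "t \<in> dyadic j i" "x \<in> dyadic j i"
      unfolding F_def by auto
    have "\<bar>t - x\<bar> \<le> 1 / 2 ^ j" using t(2,3) by (rule dyadic_dist)
    also have "\<dots> \<le> 1" by simp
    finally show "x \<in> {a - 1..b + 1}"
      using t(1) unfolding atLeastAtMost_iff by linarith
  qed
  have "emeasure lborel (\<Union>(j, i)\<in>F. dyadic j i) \<le> emeasure lborel {a - 1..b + 1}"
    using sub by (intro emeasure_mono) auto
  also have "\<dots> = ennreal m" using assms(3) by (simp add: m_def)
  finally have "ennreal C * emeasure lborel (\<Union>(j, i)\<in>F. dyadic j i) \<le> ennreal C * ennreal m"
    by (rule mult_left_mono) simp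
  also have "\<dots> = ennreal (C * m)" using \<open>m > 0\<close> by (simp add: ennreal_mult C_def)
  also have "\<dots> \<le> ennreal \<epsilon>"
    using k \<open>m > 0\<close> by (intro ennreal_leI) (simp add: C_def pos_less_divide_eq)
  finally have meas: "ennreal C * emeasure lborel (\<Union>(j, i)\<in>F. dyadic j i) \<le> ennreal \<epsilon>" .
  have small: "bounded (f ` (Z \<inter> dyadic j i)) \<and> diameter (f ` (Z \<inter> dyadic j i)) powr (1 / \<alpha>) \<le> C * (1 / 2 ^ j)"
    if "(j, i) \<in> F" for j i
    unfolding C_def
    by (rule diameter_image_powr_le) (use assms(1) that in \<open>auto simp: F_def\<close>)
  show "\<exists>F C. Z \<subseteq> (\<Union>(j, i)\<in>F. dyadic j i) \<and> C \<ge> 0 \<and>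
     (\<forall>(j, i)\<in>F. bounded (f ` (Z \<inter> dyadic j i)) \<and> diameter (f ` (Z \<inter> dyadic j i)) powr (1 / \<alpha>) \<le> C * (1 / 2 ^ j)) \<and>
     ennreal C * emeasure lborel (\<Union>(j, i)\<in>F. dyadic j i) \<le> ennreal \<epsilon>"
    using cover meas small by (intro exI[of _ F] exI[of _ C] conjI) (auto simp: C_def)
qed

section \<open>First moment bounds for percolation\<close>

definition hits :: "'q set set \<Rightarrow> ('q \<Rightarrow> bool) \<Rightarrow> bool" where
  "hits S \<omega> \<longleftrightarrow> (\<forall>b\<in>S. \<exists>Q\<in>b. \<omega> Q)"

lemma coin_sets [measurable]:
  assumes "Q \<in> I"
  shows "Measurable.pred (PiM I (\<lambda>_. measure_pmf (bernoulli_pmf p))) (\<lambda>\<omega>. \<omega> Q)"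
  using measurable_compose[OF measurable_component_singleton[OF assms], of "\<lambda>x. x" "\<lambda>_. measure_pmf (bernoulli_pmf p)" "count_space UNIV"]
  by simp

lemma hits_sets:
  assumes "finite S" "\<And>b. b \<in> S \<Longrightarrow> finite b \<and> b \<subseteq> I"
  shows "Measurable.pred (PiM I (\<lambda>_. measure_pmf (bernoulli_pmf p))) (hits S)"
proof -
  have "Measurable.pred (PiM I (\<lambda>_. measure_pmf (bernoulli_pmf p))) (\<lambda>\<omega>. \<forall>b\<in>S. \<exists>Q\<in>b. \<omega> Q)"
    using assms by (intro pred_intros_finite coin_sets) auto
  then show ?thesis unfolding hits_def[abs_def] .
qed

text \<open>The set \<open>c\<close> of coordinates forced to be 0 carries the induction: hitting
  one more block \<open>b\<close> is the event for \<open>c\<close> minus the event for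
  \<open>b \<union> c\<close>. Only cylinders with finitely many coordinates set to 0 have to be
  measured directly.\<close>

lemma measure_none_and_hits:
  fixes p :: real
  defines "M \<equiv> \<lambda>I :: 'q set. PiM I (\<lambda>_. measure_pmf (bernoulli_pmf p))"
  assumes p: "0 \<le> p" "p \<le> 1"
    and "finite S" "\<And>b. b \<in> S \<Longrightarrow> finite b \<and> b \<subseteq> I" "disjoint S"
    and "finite c" "c \<subseteq> I" "\<And>b. b \<in> S \<Longrightarrow> b \<inter> c = {}"
  shows "measure (M I) {\<omega> \<in> space (M I). hits S \<omega> \<and> (\<forall>Q\<in>c. \<not> \<omega> Q)}
    = (\<Prod>b\<in>S. 1 - (1 - p) ^ card b) * (1 - p) ^ card c"
  using assms(4-)
proof (induction S arbitrary: c rule: finite_induct)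
  case empty
  interpret product_prob_space "\<lambda>_::'q. measure_pmf (bernoulli_pmf p)" I
    by unfold_locales
  have "emeasure (M I) {\<omega> \<in> space (M I). \<forall>Q\<in>c. \<omega> Q \<in> {False}} = (\<Prod>Q\<in>c. emeasure (measure_pmf (bernoulli_pmf p)) {False})"
    unfolding M_def by (rule emeasure_PiM_Collect) (use empty in auto)
  also have "\<dots> = ennreal ((1 - p) ^ card c)"
    using p by (simp add: emeasure_pmf_single ennreal_power)
  finally show ?case
    using p by (simp add: measure_def hits_def)
next
  case (insert b S)
  interpret product_prob_space "\<lambda>_::'q. measure_pmf (bernoulli_pmf p)" I
    by unfold_locales
  have bS: "b \<inter> b' = {}" if "b' \<in> S" for b'
    using insert.prems(2) insert.hyps(2) that by (auto simp: pairwise_insert disjnt_def)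
  have disj: "disjoint S"
    using insert.prems(2) by (auto simp: pairwise_insert)
  have b: "finite b" "b \<subseteq> I" "b \<inter> c = {}" and c: "finite c" "c \<subseteq> I"
    and S: "\<And>b. b \<in> S \<Longrightarrow> finite b \<and> b \<subseteq> I"
    using insert.prems(1)[of b] insert.prems by simp_all
  have Sc: "b' \<inter> c = {}" if "b' \<in> S" for b'
    using insert.prems(5)[of b'] that by simp
  let ?E = "\<lambda>c. {\<omega> \<in> space (M I). hits S \<omega> \<and> (\<forall>Q\<in>c. \<not> \<omega> Q)}"
  have meas: "?E c' \<in> sets (M I)" if "finite c'" "c' \<subseteq> I" for c'
  proof -
    have "Measurable.pred (M I) (\<lambda>\<omega>. \<forall>Q\<in>c'. \<not> \<omega> Q)"
      unfolding M_def using that by (intro pred_intros_finite pred_intros_logic coin_sets) auto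
    moreover have "Measurable.pred (M I) (hits S)"
      unfolding M_def using insert by (intro hits_sets) auto
    ultimately show ?thesis by measurable
  qed
  have "{\<omega> \<in> space (M I). hits (insert b S) \<omega> \<and> (\<forall>Q\<in>c. \<not> \<omega> Q)} = ?E c - ?E (b \<union> c)"
    by (auto simp: hits_def)
  moreover have "measure (M I) (?E c - ?E (b \<union> c)) = measure (M I) (?E c) - measure (M I) (?E (b \<union> c))"
  proof -
    have "?E c \<in> sets (M I)" "?E (b \<union> c) \<in> sets (M I)"
      by (rule meas; simp add: b c)+
    moreover have "?E (b \<union> c) \<subseteq> ?E c" by blast
    ultimately show ?thesis unfolding M_def by (rule finite_measure_Diff)
  qed
  moreover have "measure (M I) (?E c) = (\<Prod>b\<in>S. 1 - (1 - p) ^ card b) * (1 - p) ^ card c"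
    by (rule insert.IH) (simp_all add: S Sc disj c)
  moreover have "measure (M I) (?E (b \<union> c)) = (\<Prod>b\<in>S. 1 - (1 - p) ^ card b) * (1 - p) ^ card (b \<union> c)"
    by (rule insert.IH) (simp_all add: S disj b c bS Sc Int_Un_distrib Int_commute[of _ b])
  moreover have "card (b \<union> c) = card b + card c"
    by (rule card_Un_disjoint[OF b(1) c(1) b(3)])
  ultimately show ?case
    using insert.hyps by (simp add: power_add algebra_simps)
qed

lemma measure_hits_le:
  fixes p :: real
  assumes p: "0 \<le> p" "p \<le> 1"
    and "finite S" "\<And>b. b \<in> S \<Longrightarrow> finite b \<and> b \<subseteq> I \<and> card b \<le> K" "disjoint S"
  shows "measure (PiM I (\<lambda>_. measure_pmf (bernoulli_pmf p))) {\<omega> \<in> space (PiM I (\<lambda>_. measure_pmf (bernoulli_pmf p))). hits S \<omega>}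
    \<le> (1 - (1 - p) ^ K) ^ card S"
proof -
  have "measure (PiM I (\<lambda>_. measure_pmf (bernoulli_pmf p))) {\<omega> \<in> space (PiM I (\<lambda>_. measure_pmf (bernoulli_pmf p))). hits S \<omega>}
      = (\<Prod>b\<in>S. 1 - (1 - p) ^ card b)"
    using measure_none_and_hits[OF assms(1-3), of I "{}"] assms(4,5) by simp
  also have "\<dots> \<le> (\<Prod>b\<in>S. 1 - (1 - p) ^ K)"
    using p assms(4) by (intro prod_mono) (auto simp: power_le_one intro!: power_decreasing)
  finally show ?thesis by simp
qed

text \<open>An outer probability bound in the form of a first moment: \<open>A\<close> implies one of finitely many
  configurations, each of which demands a chosen cube in every one of its disjoint blocks. Unlike
  probabilities, these bounds need no measurability of \<open>A\<close>, and they multiply over disjoint sets of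
  levels.\<close>

definition coverable :: "(nat \<Rightarrow> 'q set) \<Rightarrow> nat \<Rightarrow> real \<Rightarrow> nat set \<Rightarrow> (('q \<Rightarrow> bool) \<Rightarrow> bool) \<Rightarrow> real \<Rightarrow> bool" where
  "coverable G K \<sigma> \<Lambda> A w \<longleftrightarrow> (\<exists>\<S>. finite \<S> \<and>
     (\<forall>S\<in>\<S>. finite S \<and> disjoint S \<and> (\<forall>b\<in>S. b \<noteq> {} \<and> finite b \<and> card b \<le> K \<and> (\<exists>n\<in>\<Lambda>. b \<subseteq> G n))) \<and>
     (\<forall>\<omega>. A \<omega> \<longrightarrow> (\<exists>S\<in>\<S>. hits S \<omega>)) \<and> (\<Sum>S\<in>\<S>. \<sigma> ^ card S) \<le> w)"

lemma coverable_mono: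
  assumes "coverable G K \<sigma> \<Lambda> A w" and "\<Lambda> \<subseteq> \<Lambda>'" and "\<And>\<omega>. A' \<omega> \<Longrightarrow> A \<omega>" and "w \<le> w'"
  shows "coverable G K \<sigma> \<Lambda>' A' w'"
proof -
  obtain \<S> where "finite \<S>"
    "\<forall>S\<in>\<S>. finite S \<and> disjoint S \<and> (\<forall>b\<in>S. b \<noteq> {} \<and> finite b \<and> card b \<le> K \<and> (\<exists>n\<in>\<Lambda>. b \<subseteq> G n))"
    "\<forall>\<omega>. A \<omega> \<longrightarrow> (\<exists>S\<in>\<S>. hits S \<omega>)" "(\<Sum>S\<in>\<S>. \<sigma> ^ card S) \<le> w"
    using assms(1) unfolding coverable_def by blast
  then show ?thesis
    unfolding coverable_def using assms(2-) by (intro exI[of _ \<S>] conjI) (blast, fast, blast, linarith)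
qed

lemma coverable_True: "coverable G K \<sigma> \<Lambda> (\<lambda>_. True) 1"
  unfolding coverable_def by (rule exI[of _ "{{}}"]) (simp add: hits_def)

lemma coverable_False: "coverable G K \<sigma> \<Lambda> (\<lambda>_. False) 0"
  unfolding coverable_def by (rule exI[of _ "{}"]) simp

lemma coverable_disj:
  assumes "coverable G K \<sigma> \<Lambda> A w" and "coverable G K \<sigma> \<Lambda> B v" and "\<sigma> \<ge> 0"
  shows "coverable G K \<sigma> \<Lambda> (\<lambda>\<omega>. A \<omega> \<or> B \<omega>) (w + v)"
proof -
  obtain \<S> where S: "finite \<S>"
    "\<forall>S\<in>\<S>. finite S \<and> disjoint S \<and> (\<forall>b\<in>S. b \<noteq> {} \<and> finite b \<and> card b \<le> K \<and> (\<exists>n\<in>\<Lambda>. b \<subseteq> G n))"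
    "\<forall>\<omega>. A \<omega> \<longrightarrow> (\<exists>S\<in>\<S>. hits S \<omega>)" "(\<Sum>S\<in>\<S>. \<sigma> ^ card S) \<le> w"
    using assms(1) unfolding coverable_def by blast
  obtain \<T> where T: "finite \<T>"
    "\<forall>S\<in>\<T>. finite S \<and> disjoint S \<and> (\<forall>b\<in>S. b \<noteq> {} \<and> finite b \<and> card b \<le> K \<and> (\<exists>n\<in>\<Lambda>. b \<subseteq> G n))"
    "\<forall>\<omega>. B \<omega> \<longrightarrow> (\<exists>S\<in>\<T>. hits S \<omega>)" "(\<Sum>S\<in>\<T>. \<sigma> ^ card S) \<le> v"
    using assms(2) unfolding coverable_def by blast
  have "(\<Sum>S\<in>\<S> \<union> \<T>. \<sigma> ^ card S) \<le> w + v"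
    using S(4) T(4) sum_nonneg[of "\<S> \<inter> \<T>" "\<lambda>S. \<sigma> ^ card S"] \<open>\<sigma> \<ge> 0\<close>
    by (simp add: sum_Un[OF S(1) T(1)])
  then show ?thesis
    unfolding coverable_def using S(1-3) T(1-3) by (intro exI[of _ "\<S> \<union> \<T>"] conjI) (simp, fast, fast)
qed

lemma coverable_bex:
  assumes "finite I" and "\<And>i. i \<in> I \<Longrightarrow> coverable G K \<sigma> \<Lambda> (A i) w" and "\<sigma> \<ge> 0"
  shows "coverable G K \<sigma> \<Lambda> (\<lambda>\<omega>. \<exists>i\<in>I. A i \<omega>) (real (card I) * w)"
  using assms(1,2)
proof (induction I rule: finite_induct)
  case empty
  then show ?case using coverable_False by simp
next
  case (insert i I)
  have "coverable G K \<sigma> \<Lambda> (\<lambda>\<omega>. A i \<omega> \<or> (\<exists>i\<in>I. A i \<omega>)) (w + real (card I) * w)"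
    using insert by (intro coverable_disj \<open>\<sigma> \<ge> 0\<close>) auto
  then show ?case
    using insert by (simp add: algebra_simps)
qed

text \<open>Blocks from different levels are disjoint, so the union of two configurations is again
  one and the weights multiply. Nonemptiness of blocks matters here: an empty block could belong to
  both configurations and would be counted only once in the union.\<close>

lemma coverable_conj:
  assumes "coverable G K \<sigma> \<Lambda> A w" and "coverable G K \<sigma> \<Lambda>' B v" and "\<sigma> \<ge> 0"
    and "\<Lambda> \<inter> \<Lambda>' = {}" and G: "\<And>n n'. n \<noteq> n' \<Longrightarrow> G n \<inter> G n' = {}"
  shows "coverable G K \<sigma> (\<Lambda> \<union> \<Lambda>') (\<lambda>\<omega>. A \<omega> \<and> B \<omega>) (w * v)"
proof -
  obtain \<S> where S: "finite \<S>"
    "\<forall>S\<in>\<S>. finite S \<and> disjoint S \<and> (\<forall>b\<in>S. b \<noteq> {} \<and> finite b \<and> card b \<le> K \<and> (\<exists>n\<in>\<Lambda>. b \<subseteq> G n))"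
    "\<forall>\<omega>. A \<omega> \<longrightarrow> (\<exists>S\<in>\<S>. hits S \<omega>)" "(\<Sum>S\<in>\<S>. \<sigma> ^ card S) \<le> w"
    using assms(1) unfolding coverable_def by blast
  obtain \<T> where T: "finite \<T>"
    "\<forall>S\<in>\<T>. finite S \<and> disjoint S \<and> (\<forall>b\<in>S. b \<noteq> {} \<and> finite b \<and> card b \<le> K \<and> (\<exists>n\<in>\<Lambda>'. b \<subseteq> G n))"
    "\<forall>\<omega>. B \<omega> \<longrightarrow> (\<exists>S\<in>\<T>. hits S \<omega>)" "(\<Sum>S\<in>\<T>. \<sigma> ^ card S) \<le> v"
    using assms(2) unfolding coverable_def by blast
  let ?f = "\<lambda>(S, T). S \<union> T"
  have across: "b \<inter> b' = {}" "b \<noteq> b'" if "S \<in> \<S>" "T \<in> \<T>" "b \<in> S" "b' \<in> T" for S T b b'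
  proof -
    have "\<exists>n\<in>\<Lambda>. b \<subseteq> G n" "\<exists>n\<in>\<Lambda>'. b' \<subseteq> G n"
      using S(2) T(2) that by simp_all
    then obtain n n' where n: "n \<in> \<Lambda>" "b \<subseteq> G n" "n' \<in> \<Lambda>'" "b' \<subseteq> G n'"
      by blast
    then have "n \<noteq> n'" using assms(4) by blast
    then show "b \<inter> b' = {}" using G n by blast
    moreover have "b \<noteq> {}" using S(2) that by blast
    ultimately show "b \<noteq> b'" by auto
  qed
  have un: "disjoint (S \<union> T) \<and> card (S \<union> T) = card S + card T" if "S \<in> \<S>" "T \<in> \<T>" for S T
  proof
    show "disjoint (S \<union> T)"
      using S(2) T(2) that across[OF that] unfolding pairwise_def disjnt_def
      by (metis Int_commute Un_iff)
    show "card (S \<union> T) = card S + card T"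
      using S(2) T(2) that across(2)[OF that] by (intro card_Un_disjoint) blast+
  qed
  \<comment> \<open>Different pairs may have the same union, hence only an inequality.\<close>
  have "(\<Sum>U\<in>?f ` (\<S> \<times> \<T>). \<sigma> ^ card U) \<le> sum ((\<lambda>U. \<sigma> ^ card U) \<circ> ?f) (\<S> \<times> \<T>)"
    using S(1) T(1) \<open>\<sigma> \<ge> 0\<close> by (intro sum_image_le) auto
  also have "\<dots> = (\<Sum>(S, T)\<in>\<S> \<times> \<T>. \<sigma> ^ card S * \<sigma> ^ card T)"
    using un by (intro sum.cong) (auto simp: power_add)
  also have "\<dots> = (\<Sum>S\<in>\<S>. \<sigma> ^ card S) * (\<Sum>T\<in>\<T>. \<sigma> ^ card T)"
    by (simp add: sum_product sum.cartesian_product)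
  also have "\<dots> \<le> w * v"
  proof (rule mult_mono)
    have "0 \<le> (\<Sum>S\<in>\<S>. \<sigma> ^ card S)" using \<open>\<sigma> \<ge> 0\<close> by (intro sum_nonneg) auto
    then show "0 \<le> w" using S(4) by linarith
  qed (use S(4) T(4) \<open>\<sigma> \<ge> 0\<close> in \<open>auto intro: sum_nonneg\<close>)
  finally have weight: "(\<Sum>U\<in>?f ` (\<S> \<times> \<T>). \<sigma> ^ card U) \<le> w * v" .
  show ?thesis
    unfolding coverable_def
  proof (intro exI[of _ "?f ` (\<S> \<times> \<T>)"] conjI ballI allI impI weight)
    show "finite (?f ` (\<S> \<times> \<T>))" using S(1) T(1) by simp
    fix U assume "U \<in> ?f ` (\<S> \<times> \<T>)"
    then obtain S T where ST: "S \<in> \<S>" "T \<in> \<T>" "U = S \<union> T" by auto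
    then show "finite U" "disjoint U" using S(2) T(2) un by simp_all
    fix b assume "b \<in> U"
    then have "b \<noteq> {} \<and> finite b \<and> card b \<le> K \<and> (\<exists>n\<in>\<Lambda> \<union> \<Lambda>'. b \<subseteq> G n)"
      unfolding ST(3) using S(2)[THEN bspec, OF ST(1)] T(2)[THEN bspec, OF ST(2)]
      by (elim UnE) blast+
    then show "b \<noteq> {}" "finite b" "card b \<le> K" "\<exists>n\<in>\<Lambda> \<union> \<Lambda>'. b \<subseteq> G n"
      by simp_all
  next
    fix \<omega> assume "A \<omega> \<and> B \<omega>"
    then obtain S T where ST: "S \<in> \<S>" "hits S \<omega>" "T \<in> \<T>" "hits T \<omega>" using S(3) T(3) by blast
    then have "hits (S \<union> T) \<omega>" by (auto simp: hits_def)
    then show "\<exists>U\<in>?f ` (\<S> \<times> \<T>). hits U \<omega>" using ST by force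
  qed
qed

lemma coverable_outer_measure:
  fixes p :: real
  assumes p: "0 \<le> p" "p \<le> 1" and "coverable G K (1 - (1 - p) ^ K) \<Lambda> A w" and "\<And>n. G n \<subseteq> I"
  shows "\<exists>X \<in> sets (PiM I (\<lambda>_. measure_pmf (bernoulli_pmf p))).
    {\<omega> \<in> space (PiM I (\<lambda>_. measure_pmf (bernoulli_pmf p))). A \<omega>} \<subseteq> X \<and>
    measure (PiM I (\<lambda>_. measure_pmf (bernoulli_pmf p))) X \<le> w"
proof -
  let ?M = "PiM I (\<lambda>_. measure_pmf (bernoulli_pmf p))"
  obtain \<S> where S: "finite \<S>"
    "\<forall>S\<in>\<S>. finite S \<and> disjoint S \<and> (\<forall>b\<in>S. b \<noteq> {} \<and> finite b \<and> card b \<le> K \<and> (\<exists>n\<in>\<Lambda>. b \<subseteq> G n))"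
    "\<forall>\<omega>. A \<omega> \<longrightarrow> (\<exists>S\<in>\<S>. hits S \<omega>)" "(\<Sum>S\<in>\<S>. (1 - (1 - p) ^ K) ^ card S) \<le> w"
    using assms(3) unfolding coverable_def by blast
  let ?X = "\<lambda>S. {\<omega> \<in> space ?M. hits S \<omega>}"
  have b: "finite b \<and> b \<subseteq> I \<and> card b \<le> K" if "S \<in> \<S>" "b \<in> S" for S b
    using S(2) that assms(4) by (meson order.trans)
  have sets: "?X S \<in> sets ?M" if "S \<in> \<S>" for S
    by (rule predE, rule hits_sets) (use S(2)[THEN bspec, OF that] b[OF that] in simp_all)
  have "measure ?M (\<Union>S\<in>\<S>. ?X S) \<le> (\<Sum>S\<in>\<S>. measure ?M (?X S))"
    by (rule measure_UNION_le[OF S(1) sets])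
  also have "\<dots> \<le> (\<Sum>S\<in>\<S>. (1 - (1 - p) ^ K) ^ card S)"
    using S(2) by (intro sum_mono measure_hits_le[OF p] b) simp_all
  finally have "measure ?M (\<Union>S\<in>\<S>. ?X S) \<le> w" using S(4) by linarith
  moreover have "(\<Union>S\<in>\<S>. ?X S) \<in> sets ?M"
    by (rule sets.finite_UN[OF S(1) sets])
  moreover have "{\<omega> \<in> space ?M. A \<omega>} \<subseteq> (\<Union>S\<in>\<S>. ?X S)"
    using S(3) by blast
  ultimately show ?thesis by blast
qed

section \<open>Almost straight segments in the percolation set\<close>

definition int_box :: "('d \<Rightarrow> int) \<Rightarrow> nat \<Rightarrow> ('d \<Rightarrow> int) set" where
  "int_box a k = {Z. \<forall>i. a i \<le> Z i \<and> Z i < a i + int k}"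

lemma int_box_eq_PiE: "int_box a k = (\<Pi>\<^sub>E i\<in>UNIV. {a i..<a i + int k})"
  unfolding int_box_def by (auto simp: PiE_def Pi_def extensional_def)

lemma finite_int_box: "finite (int_box (a :: 'd::finite \<Rightarrow> int) k)"
  unfolding int_box_eq_PiE by (intro finite_PiE) auto

lemma card_int_box: "card (int_box (a :: 'd::finite \<Rightarrow> int) k) = k ^ CARD('d)"
  unfolding int_box_eq_PiE by (subst card_PiE) auto

text \<open>Half-open cells of side 1/s partition the space. Countably many of them stand in for the
  uncountably many possible points in the first moment bounds.\<close>

definition cell :: "real \<Rightarrow> ('d \<Rightarrow> int) \<Rightarrow> (real ^ 'd) set" where
  "cell s Y = {y. \<forall>i. \<lfloor>s * y $ i\<rfloor> = Y i}"

lemma mem_cell_floor: "y \<in> cell s (\<lambda>i. \<lfloor>s * y $ i\<rfloor>)"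
  by (simp add: cell_def)

lemma cell_bounds:
  assumes "y \<in> cell s Y"
  shows "of_int (Y i) \<le> s * y $ i" and "s * y $ i < of_int (Y i) + 1"
proof -
  have "\<lfloor>s * y $ i\<rfloor> = Y i" using assms by (simp add: cell_def)
  then show "of_int (Y i) \<le> s * y $ i" "s * y $ i < of_int (Y i) + 1" by linarith+
qed

lemma grid_cube_width:
  fixes Q :: "(real ^ 'd) set"
  assumes "Q \<in> grid_cubes N n" "N > 0" "e \<in> Q" "e' \<in> Q"
  shows "\<bar>real N ^ n * e $ i - real N ^ n * e' $ i\<bar> \<le> 1"
proof -
  obtain l :: "'d \<Rightarrow> nat" where l: "Q = cbox (\<chi> i. (real (l i) - 1) / real N ^ n) (\<chi> i. real (l i) / real N ^ n)"
    using assms(1) unfolding grid_cubes_def by blast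
  have "real (l i) - 1 \<le> real N ^ n * x $ i \<and> real N ^ n * x $ i \<le> real (l i)" if "x \<in> Q" for x
    using that \<open>N > 0\<close> unfolding l mem_box_cart by (simp add: pos_divide_le_eq pos_le_divide_eq mult.commute)
  from this[OF assms(3)] this[OF assms(4)] show ?thesis by linarith
qed

lemma grid_cubes_levels_disjoint:
  assumes "N \<ge> 2" "n \<noteq> n'"
  shows "grid_cubes N n \<inter> (grid_cubes N n' :: (real ^ 'd) set set) = {}"
proof (rule ccontr)
  assume "grid_cubes N n \<inter> (grid_cubes N n' :: (real ^ 'd) set set) \<noteq> {}"
  then obtain l l' :: "'d \<Rightarrow> nat" where
    eq: "cbox (\<chi> i. (real (l i) - 1) / real N ^ n) (\<chi> i. real (l i) / real N ^ n)
      = cbox (\<chi> i. (real (l' i) - 1) / real N ^ n') (\<chi> i. real (l' i) / real N ^ n')"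
    unfolding grid_cubes_def by blast
  have "cbox (\<chi> i. (real (l i) - 1) / real N ^ n) (\<chi> i. real (l i) / real N ^ n) \<noteq> ({} :: (real ^ 'd) set)"
    by (auto simp: interval_ne_empty_cart divide_right_mono)
  with eq have diff: "(real (l i) - 1) / real N ^ n = (real (l' i) - 1) / real N ^ n'" "real (l i) / real N ^ n = real (l' i) / real N ^ n'" for i
    unfolding eq_cbox by (auto simp: vec_eq_iff)
  have "1 / real N ^ n = real (l i) / real N ^ n - (real (l i) - 1) / real N ^ n" for i
    by (simp flip: diff_divide_distrib)
  also have "\<dots> i = 1 / real N ^ n'" for i
    unfolding diff by (simp flip: diff_divide_distrib)
  finally have "real N ^ n = real N ^ n'" by simp
  then show False
    using assms by (simp add: power_inject_exp)
qed

text \<open>Coordinates are in units of the cube side. The 3 is a distance of at most 2 from the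
  segment to a chosen cube, as in \<open>flat_at\<close>, plus 1 for rounding the end points of the
  segment.\<close>

definition near_block :: "nat \<Rightarrow> nat \<Rightarrow> ('d \<Rightarrow> real) \<Rightarrow> (real ^ 'd) set set" where
  "near_block N n a = {Q \<in> grid_cubes N n. \<exists>e\<in>Q. \<forall>i. \<bar>real N ^ n * e $ i - a i\<bar> \<le> 3}"

lemma near_block_finite_card:
  fixes a :: "'d::finite \<Rightarrow> real"
  assumes "N > 0"
  shows "finite (near_block N n a)" and "card (near_block N n a) \<le> 9 ^ CARD('d)"
proof -
  let ?f = "\<lambda>l :: 'd \<Rightarrow> int. cbox (\<chi> i. (of_int (l i) - 1) / real N ^ n) (\<chi> i. of_int (l i) / real N ^ n) :: (real ^ 'd) set"
  \<comment> \<open>The upper corner \<open>l i\<close> lies between a i - 3 and a i + 4, so nine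
    consecutive integers contain it.\<close>
  let ?B = "int_box (\<lambda>i. \<lceil>a i - 4\<rceil>) 9"
  have sub: "near_block N n a \<subseteq> ?f ` ?B"
  proof
    fix Q assume "Q \<in> near_block N n a"
    then obtain e where Q: "Q \<in> grid_cubes N n" and e: "e \<in> Q" "\<And>i. \<bar>real N ^ n * e $ i - a i\<bar> \<le> 3"
      unfolding near_block_def by blast
    obtain l :: "'d \<Rightarrow> nat" where l: "Q = cbox (\<chi> i. (real (l i) - 1) / real N ^ n) (\<chi> i. real (l i) / real N ^ n)"
      using Q unfolding grid_cubes_def by blast
    have le: "real (l i) - 1 \<le> real N ^ n * e $ i \<and> real N ^ n * e $ i \<le> real (l i)" for i
      using e(1) \<open>N > 0\<close> unfolding l mem_box_cart by (simp add: pos_divide_le_eq pos_le_divide_eq mult.commute)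
    have "\<lceil>a i - 4\<rceil> \<le> int (l i) \<and> int (l i) < \<lceil>a i - 4\<rceil> + 9" for i
      using le[of i] e(2)[of i] by linarith
    then have "(\<lambda>i. int (l i)) \<in> ?B" by (simp add: int_box_def)
    then have "?f (\<lambda>i. int (l i)) \<in> ?f ` ?B" by (rule imageI)
    then show "Q \<in> ?f ` ?B" by (simp only: l of_int_of_nat_eq)
  qed
  show "finite (near_block N n a)"
    by (rule finite_subset[OF sub finite_imageI[OF finite_int_box]])
  have "card (near_block N n a) \<le> card (?f ` ?B)"
    by (rule card_mono[OF finite_imageI[OF finite_int_box] sub])
  also have "\<dots> \<le> card ?B"
    by (rule card_image_le[OF finite_int_box])
  finally show "card (near_block N n a) \<le> 9 ^ CARD('d)"
    by (simp add: card_int_box)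
qed

text \<open>7 = 3 + 1 + 3: the tolerances of both blocks and the width of a common cube.\<close>

lemma near_block_disjoint:
  assumes "N > 0" "\<bar>a i - a' i\<bar> > 7"
  shows "near_block N n a \<inter> near_block N n a' = {}"
proof (rule ccontr)
  assume "near_block N n a \<inter> near_block N n a' \<noteq> {}"
  then obtain Q e e' where Q: "Q \<in> grid_cubes N n" "e \<in> Q" "e' \<in> Q"
    and e: "\<bar>real N ^ n * e $ i - a i\<bar> \<le> 3" "\<bar>real N ^ n * e' $ i - a' i\<bar> \<le> 3"
    unfolding near_block_def by blast
  then have "\<bar>a i - a' i\<bar> \<le> 7"
    using grid_cube_width[OF Q(1) assms(1) Q(2,3), of i] by linarith
  with assms(2) show False by simp
qed

text \<open>At level n segments have length L^(-n) with L = N^(3m). They are tested against cubes of side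
  L^(-n) / R with R = N^m, so that different n use different levels of the grid.\<close>

definition flat_at :: "nat \<Rightarrow> nat \<Rightarrow> ((real ^ 'd) set \<Rightarrow> bool) \<Rightarrow> nat \<Rightarrow> real ^ 'd \<Rightarrow> bool" where
  "flat_at N m \<omega> n y \<longleftrightarrow> (\<exists>z. norm (z - y) = 1 / real (N ^ (3 * m)) ^ n \<and>
     (\<forall>p\<in>closed_segment y z. \<exists>e\<in>\<Union>(chosen_cubes N \<omega> (3 * m * n + m)). norm (p - e) \<le> 2 / real N ^ (3 * m * n + m)))"

lemma exists_large_component:
  fixes x :: "real ^ 'd"
  shows "\<exists>i. norm x \<le> real CARD('d) * \<bar>x $ i\<bar>"
proof (rule ccontr)
  assume "\<nexists>i. norm x \<le> real CARD('d) * \<bar>x $ i\<bar>"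
  then have "\<bar>x $ i\<bar> < norm x / real CARD('d)" for i
    by (simp add: pos_less_divide_eq mult.commute not_le)
  then have "(\<Sum>i\<in>UNIV. \<bar>x $ i\<bar>) < (\<Sum>i::'d\<in>UNIV. norm x / real CARD('d))"
    by (intro sum_strict_mono) auto
  then show False using norm_le_l1_cart[of x] by simp
qed

definition sample :: "nat \<Rightarrow> ('d \<Rightarrow> int) \<Rightarrow> ('d \<Rightarrow> int) \<Rightarrow> nat \<Rightarrow> 'd \<Rightarrow> real" where
  "sample K y z q i = of_int (y i) + real q / real K * of_int (z i - y i)"

text \<open>Rounding the end points of the segment to the grid leaves polynomially many candidates, and K
  sample points on each of them are so far apart that the blocks of cubes around them are disjoint.\<close>

lemma flat_coverable:
  fixes Y :: "'d::finite \<Rightarrow> int"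
  assumes K_def: "K = N ^ m div (8 * CARD('d))" and "N > 0" and "K \<ge> 1" and \<sigma>: "0 \<le> \<sigma>"
  shows "coverable (\<lambda>n. grid_cubes N (3 * m * n + m)) (9 ^ CARD('d)) \<sigma> {n}
    (\<lambda>\<omega>. \<exists>y\<in>cell (real (N ^ (3 * m)) ^ n) Y. flat_at N m \<omega> n y)
    (real ((3 * (N ^ m)\<^sup>2) ^ CARD('d)) * \<sigma> ^ K)"
proof -
  define R where "R = N ^ m"
  define s where "s = real (N ^ (3 * m)) ^ n"
  define h where "h = real N ^ (3 * m * n + m)"
  have pos: "R > 0" "s > 0" "h > 0" using \<open>N > 0\<close> by (simp_all add: R_def s_def h_def)
  have h: "h = s * real R"
    by (simp add: h_def s_def R_def power_add power_mult)
  let ?blocks = "\<lambda>(y, z). (\<lambda>q. near_block N (3 * m * n + m) (sample K y z q)) ` {..<K}"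
  \<comment> \<open>In each coordinate the cell of y splits into R cells at the finer resolution,
    and z is at most R fine cells away, which leaves 3 R values: (3 R^2)^d pairs in all.\<close>
  define P where "P = int_box (\<lambda>i. int R * Y i) R \<times> int_box (\<lambda>i. int R * Y i - int R) (3 * R)"
  \<comment> \<open>The first condition makes the sample points more than 7 apart in one coordinate.
    The second provides the nonempty blocks that \<open>coverable\<close> asks for; near points
    outside the unit cube a block may be empty.\<close>
  define P' where "P' = {(y, z) \<in> P. (\<exists>i. 7 * int K < \<bar>z i - y i\<bar>) \<and> (\<forall>q<K. near_block N (3 * m * n + m) (sample K y z q) \<noteq> {})}"
  have finP: "finite P" unfolding P_def by (rule finite_cartesian_product[OF finite_int_box finite_int_box])
  then have finP': "finite P'" unfolding P'_def by (rule rev_finite_subset) auto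
  have cardP: "card P = (3 * R\<^sup>2) ^ CARD('d)"
    by (simp add: P_def card_cartesian_product card_int_box power2_eq_square power_mult_distrib algebra_simps)
  have apart: "near_block N (3 * m * n + m) (sample K y z q) \<inter> near_block N (3 * m * n + m) (sample K y z q') = {}"
    if "(y, z) \<in> P'" "q \<noteq> q'" for y z q q'
  proof -
    have "\<exists>i. 7 * int K < \<bar>z i - y i\<bar>" using that(1) unfolding P'_def by blast
    then obtain i where "7 * int K < \<bar>z i - y i\<bar>" by blast
    then have i: "7 * real K < \<bar>of_int (z i - y i)\<bar>" by linarith
    have "1 \<le> \<bar>real q - real q'\<bar>" using that(2) by linarith
    have "7 < \<bar>of_int (z i - y i)\<bar> / real K"
      using i \<open>K \<ge> 1\<close> by (simp add: pos_less_divide_eq)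
    also have "\<dots> \<le> \<bar>real q - real q'\<bar> * (\<bar>of_int (z i - y i)\<bar> / real K)"
      using mult_right_mono[OF \<open>1 \<le> \<bar>real q - real q'\<bar>\<close>, of "\<bar>of_int (z i - y i)\<bar> / real K"] by simp
    also have "\<dots> = \<bar>(real q - real q') / real K * of_int (z i - y i)\<bar>"
      by (simp add: abs_mult)
    also have "(real q - real q') / real K * of_int (z i - y i) = sample K y z q i - sample K y z q' i"
      by (simp add: sample_def diff_divide_distrib left_diff_distrib)
    finally show ?thesis by (rule near_block_disjoint[OF \<open>N > 0\<close>])
  qed
  have blocks: "disjoint (?blocks yz)" "card (?blocks yz) = K" if "yz \<in> P'" for yz
  proof -
    obtain y z where yz: "yz = (y, z)" by fastforce
    note ap = apart[OF that[unfolded yz]]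
    show "disjoint (?blocks yz)"
      unfolding yz prod.case by (rule pairwise_imageI) (simp add: disjnt_def ap)
    have "inj_on (\<lambda>q. near_block N (3 * m * n + m) (sample K y z q)) {..<K}"
    proof (rule inj_onI, rule ccontr)
      fix q q' assume q: "q \<in> {..<K}" "near_block N (3 * m * n + m) (sample K y z q) = near_block N (3 * m * n + m) (sample K y z q')" "q \<noteq> q'"
      then have "near_block N (3 * m * n + m) (sample K y z q) = {}" using ap[of q q'] by simp
      then show False using that q(1) unfolding yz P'_def by auto
    qed
    then show "card (?blocks yz) = K" unfolding yz by (simp add: card_image)
  qed
  show ?thesis
    unfolding coverable_def
  proof (intro exI[of _ "?blocks ` P'"] conjI ballI allI impI)
    show "finite (?blocks ` P')" using finP' by simp
  next
    fix S assume "S \<in> ?blocks ` P'"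
    then obtain yz where yz: "yz \<in> P'" "S = ?blocks yz" by blast
    show "finite S" unfolding yz(2) by (simp add: split_def)
    show "disjoint S" unfolding yz(2) by (rule blocks(1)[OF yz(1)])
    fix b assume "b \<in> S"
    then obtain q where q: "q < K" "b = near_block N (3 * m * n + m) (sample K (fst yz) (snd yz) q)"
      unfolding yz(2) by (auto simp: split_def)
    show "b \<noteq> {}" using yz(1) q unfolding P'_def by (auto simp: split_def)
    show "finite b" "card b \<le> 9 ^ CARD('d)"
      unfolding q(2) using near_block_finite_card[OF \<open>N > 0\<close>] by blast+
    show "\<exists>n\<in>{n}. b \<subseteq> grid_cubes N (3 * m * n + m)"
      unfolding q(2) near_block_def by blast
  next
    fix \<omega> assume "\<exists>y\<in>cell (real (N ^ (3 * m)) ^ n) Y. flat_at N m \<omega> n y"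
    then obtain y z where y: "y \<in> cell s Y" and z: "norm (z - y) = 1 / s"
      and near: "\<And>p. p \<in> closed_segment y z \<Longrightarrow> \<exists>e\<in>\<Union>(chosen_cubes N \<omega> (3 * m * n + m)). norm (p - e) \<le> 2 / h"
      unfolding flat_at_def s_def h_def by blast
    define y' where "y' i = \<lfloor>h * y $ i\<rfloor>" for i
    define z' where "z' i = \<lfloor>h * z $ i\<rfloor>" for i
    have yb: "real R * of_int (Y i) \<le> h * y $ i" "h * y $ i < real R * of_int (Y i) + real R" for i
    proof -
      have "real R * of_int (Y i) \<le> real R * (s * y $ i)"
        using cell_bounds(1)[OF y, of i] pos by (intro mult_left_mono) auto
      then show "real R * of_int (Y i) \<le> h * y $ i" by (simp add: h mult_ac)
      have "real R * (s * y $ i) < real R * (of_int (Y i) + 1)"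
        using cell_bounds(2)[OF y, of i] pos by (intro mult_strict_left_mono) auto
      then show "h * y $ i < real R * of_int (Y i) + real R" by (simp add: h algebra_simps)
    qed
    have zy: "\<bar>h * z $ i - h * y $ i\<bar> \<le> real R" for i
    proof -
      have "\<bar>h * z $ i - h * y $ i\<bar> = h * \<bar>(z - y) $ i\<bar>"
        using pos by (simp add: abs_mult flip: right_diff_distrib)
      also have "\<dots> \<le> h * norm (z - y)"
        by (rule mult_left_mono[OF component_le_norm_cart]) (simp add: pos less_imp_le)
      also have "\<dots> = real R" using pos by (simp add: z h)
      finally show ?thesis .
    qed
    have y'_mem: "y' \<in> int_box (\<lambda>i. int R * Y i) R"
      unfolding int_box_def y'_def using yb by (simp add: le_floor_iff floor_less_iff)
    have z'_mem: "z' \<in> int_box (\<lambda>i. int R * Y i - int R) (3 * R)"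
    proof -
      have "real R * of_int (Y i) - real R \<le> h * z $ i" "h * z $ i < real R * of_int (Y i) - real R + 3 * real R" for i
        using yb[of i] zy[of i] by linarith+
      then show ?thesis
        unfolding int_box_def z'_def by (simp add: le_floor_iff floor_less_iff)
    qed
    \<comment> \<open>Origin of the 8 d in \<open>K\<close>: some coordinate spans at least R/d
      \<ge> 8 K grid units, rounding loses less than 1 \<le> K, and more than 7 K units remain for K
      samples.\<close>
    obtain i where i: "norm (z - y) \<le> real CARD('d) * \<bar>(z - y) $ i\<bar>"
      using exists_large_component by blast
    have "real R \<le> real CARD('d) * \<bar>h * z $ i - h * y $ i\<bar>"
    proof -
      have "real R = h * norm (z - y)" using pos by (simp add: z h)
      also have "\<dots> \<le> h * (real CARD('d) * \<bar>(z - y) $ i\<bar>)"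
        using i pos by (intro mult_left_mono) auto
      also have "\<dots> = real CARD('d) * \<bar>h * z $ i - h * y $ i\<bar>"
        using pos by (simp add: abs_mult flip: right_diff_distrib)
      finally show ?thesis .
    qed
    moreover have "real CARD('d) * (8 * real K) \<le> real R"
    proof -
      have "8 * CARD('d) * K \<le> R"
        unfolding K_def R_def by simp
      then have "real (8 * CARD('d) * K) \<le> real R"
        by (simp only: of_nat_le_iff)
      then show ?thesis by (simp add: mult_ac)
    qed
    ultimately have "real CARD('d) * (8 * real K) \<le> real CARD('d) * \<bar>h * z $ i - h * y $ i\<bar>"
      by linarith
    then have "8 * real K \<le> \<bar>h * z $ i - h * y $ i\<bar>"
      by (rule mult_left_le_imp_le) simp
    then have "7 * int K < \<bar>z' i - y' i\<bar>"
      using \<open>K \<ge> 1\<close> unfolding y'_def z'_def by linarith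
    have block: "\<exists>Q\<in>near_block N (3 * m * n + m) (sample K y' z' q). \<omega> Q" if "q < K" for q
    proof -
      define \<theta> where "\<theta> = real q / real K"
      have \<theta>: "0 \<le> \<theta>" "\<theta> \<le> 1" using that by (simp_all add: \<theta>_def)
      define p where "p = (1 - \<theta>) *\<^sub>R y + \<theta> *\<^sub>R z"
      have "p \<in> closed_segment y z" using \<theta> unfolding p_def in_segment by blast
      then obtain e Q where Q: "Q \<in> chosen_cubes N \<omega> (3 * m * n + m)" "e \<in> Q" and pe: "norm (p - e) \<le> 2 / h"
        using near by blast
      have "\<bar>h * e $ i - sample K y' z' q i\<bar> \<le> 3" for i
      proof -
        have "\<bar>h * p $ i - h * e $ i\<bar> = h * \<bar>(p - e) $ i\<bar>"
          using pos by (simp add: abs_mult flip: right_diff_distrib)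
        also have "\<dots> \<le> h * norm (p - e)"
          by (rule mult_left_mono[OF component_le_norm_cart]) (simp add: pos less_imp_le)
        also have "\<dots> \<le> 2" using pe pos by (simp add: field_simps)
        finally have 1: "\<bar>h * p $ i - h * e $ i\<bar> \<le> 2" .
        \<comment> \<open>The sampling error is a convex combination of the rounding errors at the
          two ends, so it stays between 0 and 1.\<close>
        have eq: "h * p $ i - sample K y' z' q i = (1 - \<theta>) * (h * y $ i - y' i) + \<theta> * (h * z $ i - z' i)"
          by (simp add: p_def sample_def \<theta>_def[symmetric] algebra_simps)
        have "0 \<le> h * p $ i - sample K y' z' q i"
          unfolding eq using \<theta> by (intro add_nonneg_nonneg mult_nonneg_nonneg) (simp_all add: y'_def z'_def)
        moreover have "h * p $ i - sample K y' z' q i \<le> (1 - \<theta>) * 1 + \<theta> * 1"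
          unfolding eq y'_def z'_def using \<theta> by (intro add_mono mult_left_mono) linarith+
        ultimately have "0 \<le> h * p $ i - sample K y' z' q i" "h * p $ i - sample K y' z' q i \<le> 1"
          by simp_all
        with 1 show ?thesis by linarith
      qed
      then have "Q \<in> near_block N (3 * m * n + m) (sample K y' z' q)"
        using Q unfolding near_block_def chosen_cubes_def h_def by blast
      moreover have "\<omega> Q" using Q(1) by (simp add: chosen_cubes_def)
      ultimately show ?thesis by blast
    qed
    then have "near_block N (3 * m * n + m) (sample K y' z' q) \<noteq> {}" if "q < K" for q
      using that by blast
    then have "(y', z') \<in> P'"
      unfolding P'_def P_def using y'_mem z'_mem \<open>7 * int K < \<bar>z' i - y' i\<bar>\<close> by blast
    moreover have "hits (?blocks (y', z')) \<omega>"
      unfolding hits_def using block by auto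
    ultimately show "\<exists>S\<in>?blocks ` P'. hits S \<omega>" by blast
  next
    have "(\<Sum>S\<in>?blocks ` P'. \<sigma> ^ card S) = (\<Sum>S\<in>?blocks ` P'. \<sigma> ^ K)"
      using blocks(2) by (intro sum.cong) auto
    also have "\<dots> = real (card (?blocks ` P')) * \<sigma> ^ K" by simp
    also have "\<dots> \<le> real (card P) * \<sigma> ^ K"
    proof -
      have "card (?blocks ` P') \<le> card P'" using finP' by (rule card_image_le)
      also have "\<dots> \<le> card P" using finP by (rule card_mono) (auto simp: P'_def)
      finally show ?thesis using \<sigma> by (intro mult_right_mono) auto
    qed
    finally show "(\<Sum>S\<in>?blocks ` P'. \<sigma> ^ card S) \<le> real ((3 * (N ^ m)\<^sup>2) ^ CARD('d)) * \<sigma> ^ K"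
      unfolding cardP R_def .
  qed
qed

section \<open>Chains of almost straight segments\<close>

text \<open>All that the chain argument takes from percolation: a bad point in a cell of level n
  forces a configuration of blocks in \<open>G n\<close>, with total weight at most \<delta>
  uniformly in cell and level.\<close>

locale bad_cells =
  fixes G :: "nat \<Rightarrow> 'q set" and K :: nat and \<sigma> \<delta> :: real and L :: nat
    and bad :: "('q \<Rightarrow> bool) \<Rightarrow> nat \<Rightarrow> real ^ 'd \<Rightarrow> bool"
  assumes \<sigma>_nonneg: "0 \<le> \<sigma>" and \<delta>_nonneg: "0 \<le> \<delta>" and L_pos: "L > 0"
    and G_disjoint: "\<And>n n'. n \<noteq> n' \<Longrightarrow> G n \<inter> G n' = {}"
    and bad_coverable: "\<And>n Y. coverable G K \<sigma> {n} (\<lambda>\<omega>. \<exists>y\<in>cell (real L ^ n) Y. bad \<omega> n y) \<delta>"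
begin

abbreviation scale :: "nat \<Rightarrow> real" where
  "scale n \<equiv> 1 / real L ^ n"

lemma neighbour_cell:
  assumes "y \<in> cell (real L ^ n) Y" and "norm (y' - y) \<le> real C * scale n"
  shows "(\<lambda>i. \<lfloor>real L ^ n * y' $ i\<rfloor>) \<in> int_box (\<lambda>i. Y i - int C) (2 * C + 1)"
proof -
  have pos: "0 < real L ^ n" using L_pos by simp
  have "\<bar>real L ^ n * y' $ i - real L ^ n * y $ i\<bar> \<le> real C" for i
  proof -
    have "\<bar>real L ^ n * y' $ i - real L ^ n * y $ i\<bar> = real L ^ n * \<bar>(y' - y) $ i\<bar>"
      using pos by (simp add: abs_mult flip: right_diff_distrib)
    also have "\<dots> \<le> real L ^ n * (real C * scale n)"
      using assms(2) component_le_norm_cart[of "y' - y" i] pos by (intro mult_left_mono) auto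
    also have "\<dots> = real C" using pos by simp
    finally show ?thesis .
  qed
  then have "of_int (Y i) - real C \<le> real L ^ n * y' $ i \<and> real L ^ n * y' $ i < of_int (Y i) + 1 + real C" for i
    using cell_bounds[OF assms(1), of i] by (smt (verit))
  then have "Y i - int C \<le> \<lfloor>real L ^ n * y' $ i\<rfloor> \<and> \<lfloor>real L ^ n * y' $ i\<rfloor> < Y i - int C + int (2 * C + 1)" for i
    by (simp add: le_floor_iff floor_less_iff add_ac)
  then show ?thesis by (simp add: int_box_def)
qed

lemma refined_cell:
  assumes "y \<in> cell (real L ^ n) Y"
  shows "(\<lambda>i. \<lfloor>real L ^ (n + h) * y $ i\<rfloor>) \<in> int_box (\<lambda>i. int (L ^ h) * Y i) (L ^ h)"
proof -
  have "int (L ^ h) * Y i \<le> \<lfloor>real L ^ (n + h) * y $ i\<rfloor> \<and> \<lfloor>real L ^ (n + h) * y $ i\<rfloor> < int (L ^ h) * Y i + int (L ^ h)" for i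
  proof -
    have eq: "real L ^ (n + h) * y $ i = real L ^ h * (real L ^ n * y $ i)"
      by (simp add: power_add)
    have "real L ^ h * of_int (Y i) \<le> real L ^ (n + h) * y $ i"
      unfolding eq using cell_bounds(1)[OF assms] by (intro mult_left_mono) auto
    moreover have "real L ^ (n + h) * y $ i < real L ^ h * (of_int (Y i) + 1)"
      unfolding eq using cell_bounds(2)[OF assms] L_pos by (intro mult_strict_left_mono) auto
    ultimately show ?thesis
      by (simp add: le_floor_iff floor_less_iff distrib_left)
  qed
  then show ?thesis by (simp add: int_box_def)
qed

text \<open>Three neighbouring cells per coordinate, each split into L, give (3L)^d cells for the
  next point of a chain.\<close>

lemma next_cell:
  assumes "y \<in> cell (real L ^ n) Y" and "norm (y' - y) \<le> scale n"
  shows "(\<lambda>i. \<lfloor>real L ^ Suc n * y' $ i\<rfloor>) \<in> int_box (\<lambda>i. int L * Y i - int L) (3 * L)"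
proof -
  let ?Y' = "\<lambda>i. \<lfloor>real L ^ n * y' $ i\<rfloor>"
  have "?Y' \<in> int_box (\<lambda>i. Y i - int 1) (2 * 1 + 1)"
    by (rule neighbour_cell[OF assms(1)]) (use assms(2) in simp)
  then have Y': "Y i - 1 \<le> ?Y' i" "?Y' i \<le> Y i + 1" for i
    unfolding int_box_def by (auto dest!: spec[of _ i])
  have "(\<lambda>i. \<lfloor>real L ^ (n + 1) * y' $ i\<rfloor>) \<in> int_box (\<lambda>i. int (L ^ 1) * ?Y' i) (L ^ 1)"
    by (rule refined_cell[OF mem_cell_floor])
  then have *: "int L * ?Y' i \<le> \<lfloor>real L ^ Suc n * y' $ i\<rfloor>" "\<lfloor>real L ^ Suc n * y' $ i\<rfloor> < int L * ?Y' i + int L" for i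
    unfolding int_box_def by simp_all
  have "int L * Y i - int L \<le> int L * ?Y' i" "int L * ?Y' i \<le> int L * Y i + int L" for i
    using mult_left_mono[OF Y'(1)[of i], of "int L"] mult_left_mono[OF Y'(2)[of i], of "int L"]
    by (simp_all add: right_diff_distrib distrib_left)
  then have "int L * Y i - int L \<le> \<lfloor>real L ^ Suc n * y' $ i\<rfloor>
      \<and> \<lfloor>real L ^ Suc n * y' $ i\<rfloor> < int L * Y i - int L + int (3 * L)" for i
    using *[of i] unfolding of_nat_mult of_nat_numeral by (smt (verit))
  then show ?thesis by (simp add: int_box_def)
qed

text \<open>A union bound over discretised chains: each level contributes (3L)^d cells for the next
  point and a factor 2 for counting the present point or not. Each counted point contributes
  \<delta>, and these factors multiply because every level has its own cubes.\<close>

lemma chain_coverable: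
  "coverable G K \<sigma> {n..<n + h} (\<lambda>\<omega>. \<exists>y\<in>cell (real L ^ n) Y. bad_chain scale (bad \<omega>) h b n y)
    ((2 * real (3 * L) ^ CARD('d)) ^ h * \<delta> ^ b)"
proof (induction h arbitrary: b n Y)
  case 0
  show ?case
  proof (cases "b = 0")
    case True
    then show ?thesis by (intro coverable_mono[OF coverable_True]) auto
  next
    case False
    then show ?thesis using \<delta>_nonneg by (intro coverable_mono[OF coverable_False]) auto
  qed
next
  case (Suc h)
  define B where "B = int_box (\<lambda>i. int L * Y i - int L) (3 * L)"
  define w where "w = 2 * real (3 * L) ^ CARD('d)"
  have w: "0 \<le> w" "w = 2 * real (card B)"
    by (simp_all add: w_def B_def card_int_box)
  let ?next = "\<lambda>b \<omega>. \<exists>Y'\<in>B. \<exists>y\<in>cell (real L ^ Suc n) Y'. bad_chain scale (bad \<omega>) h b (Suc n) y"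
  have nxt: "coverable G K \<sigma> {Suc n..<Suc n + h} (?next b) (real (card B) * (w ^ h * \<delta> ^ b))" for b
    by (rule coverable_bex[OF _ _ \<sigma>_nonneg]) (use Suc.IH[of "Suc n"] in \<open>simp_all add: B_def finite_int_box w_def\<close>)
  have levels: "{n..<n + Suc h} = {n} \<union> {Suc n..<Suc n + h}" by auto
  have nxt': "coverable G K \<sigma> {n..<n + Suc h} (?next b) (real (card B) * (w ^ h * \<delta> ^ b))" for b
    using nxt by (rule coverable_mono) auto
  have next_mem: "?next b' \<omega>" if "y \<in> cell (real L ^ n) Y" "norm (y' - y) \<le> scale n" "bad_chain scale (bad \<omega>) h b' (Suc n) y'"
    for y y' b' \<omega>
    using next_cell[OF that(1,2)] that(3) mem_cell_floor[of y' "real L ^ Suc n"] unfolding B_def by blast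
  show ?case
  proof (cases b)
    case 0
    have "real (card B) * (w ^ h * \<delta> ^ b) \<le> w ^ Suc h * \<delta> ^ b"
      using w by (simp add: 0)
    then show ?thesis
      using nxt'[of b] next_mem[of _ _ _ b] unfolding w_def[symmetric]
      by (elim coverable_mono) (auto simp: 0)
  next
    case (Suc b')
    let ?here = "\<lambda>\<omega>. \<exists>y\<in>cell (real L ^ n) Y. bad \<omega> n y"
    have "coverable G K \<sigma> {n..<n + Suc h} (\<lambda>\<omega>. ?here \<omega> \<and> ?next b' \<omega>) (\<delta> * (real (card B) * (w ^ h * \<delta> ^ b')))"
      unfolding levels by (rule coverable_conj[OF bad_coverable nxt \<sigma>_nonneg _ G_disjoint]) auto
    then have "coverable G K \<sigma> {n..<n + Suc h} (\<lambda>\<omega>. ?next b \<omega> \<or> ?here \<omega> \<and> ?next b' \<omega>)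
        (real (card B) * (w ^ h * \<delta> ^ b) + \<delta> * (real (card B) * (w ^ h * \<delta> ^ b')))"
      by (rule coverable_disj[OF nxt' _ \<sigma>_nonneg])
    then show ?thesis
      unfolding w_def[symmetric]
    proof (rule coverable_mono)
      fix \<omega> assume "\<exists>y\<in>cell (real L ^ n) Y. bad_chain scale (bad \<omega>) (Suc h) b n y"
      then obtain y y' where y: "y \<in> cell (real L ^ n) Y" "norm (y' - y) \<le> scale n"
        and "bad_chain scale (bad \<omega>) h b (Suc n) y' \<or> bad \<omega> n y \<and> bad_chain scale (bad \<omega>) h b' (Suc n) y'"
        by (auto simp: Suc)
      then show "?next b \<omega> \<or> ?here \<omega> \<and> ?next b' \<omega>"
        using next_mem[OF y] y(1) by blast
    qed (simp_all add: w Suc)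
  qed
qed

section \<open>Windows of consecutive levels around a point\<close>

definition bad_window :: "nat \<Rightarrow> nat \<Rightarrow> nat \<Rightarrow> real ^ 'd \<Rightarrow> ('q \<Rightarrow> bool) \<Rightarrow> bool" where
  "bad_window C g n x \<omega> \<longleftrightarrow> (\<exists>y. norm (y - x) \<le> real C * scale n \<and> bad_chain scale (bad \<omega>) (2 * g) (Suc g) n y)"

text \<open>Three counts: cells for the start y given the cell of x, chains of 2g levels with g + 1
  counted points, and subcells for x itself before the next window starts.\<close>

definition window_weight :: "nat \<Rightarrow> nat \<Rightarrow> real" where
  "window_weight C g = real ((2 * C + 1) ^ CARD('d)) * ((2 * real (3 * L) ^ CARD('d)) ^ (2 * g) * \<delta> ^ Suc g)
     * real ((L ^ (2 * g)) ^ CARD('d))"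

text \<open>The point x is common to all windows but unknown. Its cell is refined from window to
  window, and since the windows occupy disjoint levels, their weights multiply.\<close>

lemma windows_coverable:
  "coverable G K \<sigma> {n..<n + 2 * g * M} (\<lambda>\<omega>. \<exists>x\<in>cell (real L ^ n) X. \<forall>i<M. bad_window C g (n + 2 * g * i) x \<omega>)
    (window_weight C g ^ M)"
proof (induction M arbitrary: n X)
  case 0
  show ?case by (intro coverable_mono[OF coverable_True]) auto
next
  case (Suc M)
  define A where "A = int_box (\<lambda>i. X i - int C) (2 * C + 1)"
  define B where "B = int_box (\<lambda>i. int (L ^ (2 * g)) * X i) (L ^ (2 * g))"
  let ?first = "\<lambda>\<omega>. \<exists>Y\<in>A. \<exists>y\<in>cell (real L ^ n) Y. bad_chain scale (bad \<omega>) (2 * g) (Suc g) n y"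
  let ?rest = "\<lambda>\<omega>. \<exists>X'\<in>B. \<exists>x\<in>cell (real L ^ (n + 2 * g)) X'. \<forall>i<M. bad_window C g (n + 2 * g + 2 * g * i) x \<omega>"
  have 1: "coverable G K \<sigma> {n..<n + 2 * g} ?first
      (real (card A) * ((2 * real (3 * L) ^ CARD('d)) ^ (2 * g) * \<delta> ^ Suc g))"
    by (rule coverable_bex[OF _ chain_coverable \<sigma>_nonneg]) (simp add: A_def finite_int_box)
  have 2: "coverable G K \<sigma> {n + 2 * g..<n + 2 * g + 2 * g * M} ?rest (real (card B) * window_weight C g ^ M)"
    by (rule coverable_bex[OF _ Suc.IH \<sigma>_nonneg]) (simp add: B_def finite_int_box)
  have "coverable G K \<sigma> ({n..<n + 2 * g} \<union> {n + 2 * g..<n + 2 * g + 2 * g * M}) (\<lambda>\<omega>. ?first \<omega> \<and> ?rest \<omega>)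
      (real (card A) * ((2 * real (3 * L) ^ CARD('d)) ^ (2 * g) * \<delta> ^ Suc g) * (real (card B) * window_weight C g ^ M))"
    by (rule coverable_conj[OF 1 2 \<sigma>_nonneg _ G_disjoint]) auto
  then show ?case
  proof (rule coverable_mono)
    show "{n..<n + 2 * g} \<union> {n + 2 * g..<n + 2 * g + 2 * g * M} \<subseteq> {n..<n + 2 * g * Suc M}" by auto
    show "real (card A) * ((2 * real (3 * L) ^ CARD('d)) ^ (2 * g) * \<delta> ^ Suc g) * (real (card B) * window_weight C g ^ M)
        \<le> window_weight C g ^ Suc M"
      by (simp add: window_weight_def A_def B_def card_int_box mult_ac)
    fix \<omega> assume "\<exists>x\<in>cell (real L ^ n) X. \<forall>i<Suc M. bad_window C g (n + 2 * g * i) x \<omega>"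
    then obtain x where x: "x \<in> cell (real L ^ n) X" and win: "\<And>i. i < Suc M \<Longrightarrow> bad_window C g (n + 2 * g * i) x \<omega>"
      by blast
    obtain y where y: "norm (y - x) \<le> real C * scale n" "bad_chain scale (bad \<omega>) (2 * g) (Suc g) n y"
      using win[of 0] unfolding bad_window_def by auto
    have "?first \<omega>"
      using neighbour_cell[OF x y(1)] y(2) mem_cell_floor[of y "real L ^ n"] unfolding A_def by blast
    moreover have "\<forall>i<M. bad_window C g (n + 2 * g + 2 * g * i) x \<omega>"
    proof (intro allI impI)
      fix i assume "i < M"
      then show "bad_window C g (n + 2 * g + 2 * g * i) x \<omega>"
        using win[of "Suc i"] by (simp add: add.assoc)
    qed
    then have "?rest \<omega>"
      using refined_cell[OF x, of "2 * g"] mem_cell_floor[of x "real L ^ (n + 2 * g)"] unfolding B_def by blast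
    ultimately show "?first \<omega> \<and> ?rest \<omega>" by blast
  qed
qed

text \<open>More than half of the levels are counted, so every two levels come with one factor
  \<delta>. The hypothesis says that \<delta> outweighs the branching of two levels, of chains and
  of cells for x together.\<close>

lemma window_weight_le:
  assumes "4 * real ((3 * L) * (3 * L) * (L * L)) ^ CARD('d) * \<delta> \<le> 1 / 2" and "\<delta> \<le> 1"
  shows "window_weight C g \<le> real ((2 * C + 1) ^ CARD('d)) * (1 / 2) ^ g"
proof -
  define T where "T = real (3 * L) ^ CARD('d)"
  define P where "P = real L ^ CARD('d)"
  have "real ((L ^ (2 * g)) ^ CARD('d)) = real L ^ (CARD('d) * g + CARD('d) * g)"
    by (simp only: of_nat_power flip: power_mult) (rule arg_cong2[where f = "(^)"]; simp)
  also have "\<dots> = (P * P) ^ g"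
    by (simp add: P_def power_add power_mult power_mult_distrib)
  finally have L: "real ((L ^ (2 * g)) ^ CARD('d)) = (P * P) ^ g" .
  have "(2 * T) ^ (2 * g) = (4 * (T * T)) ^ g"
    by (simp add: power_mult power2_eq_square)
  then have "window_weight C g = real ((2 * C + 1) ^ CARD('d)) * ((4 * (T * T) * (P * P) * \<delta>) ^ g * \<delta>)"
    unfolding window_weight_def L T_def[symmetric] by (simp add: power_mult_distrib mult_ac)
  also have "4 * (T * T) * (P * P) * \<delta> = 4 * real ((3 * L) * (3 * L) * (L * L)) ^ CARD('d) * \<delta>"
    by (simp only: T_def P_def of_nat_mult power_mult_distrib)
  finally have "window_weight C g = real ((2 * C + 1) ^ CARD('d)) *
      ((4 * real ((3 * L) * (3 * L) * (L * L)) ^ CARD('d) * \<delta>) ^ g * \<delta>)" .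
  also have "\<dots> \<le> real ((2 * C + 1) ^ CARD('d)) * ((1 / 2) ^ g * 1)"
    by (rule mult_left_mono[OF mult_mono[OF power_mono[OF assms(1)] assms(2)]]) (simp_all add: \<delta>_nonneg)
  finally show ?thesis by simp
qed

text \<open>The first M windows are bad only inside a measurable set of measure at most
  \<open>window_weight C g ^ M\<close>. The intersection over M is a null set, and the event itself
  is never shown to be measurable.\<close>

lemma AE_no_bad_windows:
  assumes p: "0 \<le> p" "p \<le> 1" and \<sigma>: "\<sigma> = 1 - (1 - p) ^ K" and I: "\<And>n. G n \<subseteq> I"
    and "window_weight C g < 1"
  shows "AE \<omega> in PiM I (\<lambda>_. measure_pmf (bernoulli_pmf p)). \<forall>X. \<not> (\<exists>x\<in>cell (real L ^ n) X. \<forall>i. bad_window C g (n + 2 * g * i) x \<omega>)"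
    (is "AE \<omega> in ?M. _")
proof -
  interpret prob_space ?M by (intro prob_space_PiM measure_pmf.prob_space_axioms)
  have "AE \<omega> in ?M. \<not> (\<exists>x\<in>cell (real L ^ n) X. \<forall>i. bad_window C g (n + 2 * g * i) x \<omega>)" for X
  proof -
    have "\<exists>Z\<in>sets ?M. {\<omega> \<in> space ?M. \<exists>x\<in>cell (real L ^ n) X. \<forall>i<M. bad_window C g (n + 2 * g * i) x \<omega>} \<subseteq> Z
        \<and> measure ?M Z \<le> window_weight C g ^ M" for M
      by (rule coverable_outer_measure[OF p _ I]) (use windows_coverable in \<open>simp add: \<sigma>\<close>)
    then have "\<exists>Z. \<forall>M. Z M \<in> sets ?M \<and> measure ?M (Z M) \<le> window_weight C g ^ M \<and>
        {\<omega> \<in> space ?M. \<exists>x\<in>cell (real L ^ n) X. \<forall>i<M. bad_window C g (n + 2 * g * i) x \<omega>} \<subseteq> Z M"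
      by (intro choice allI) blast
    then obtain Z where "\<forall>M. Z M \<in> sets ?M \<and> measure ?M (Z M) \<le> window_weight C g ^ M \<and>
        {\<omega> \<in> space ?M. \<exists>x\<in>cell (real L ^ n) X. \<forall>i<M. bad_window C g (n + 2 * g * i) x \<omega>} \<subseteq> Z M"
      by (rule exE)
    then have Z: "Z M \<in> sets ?M" "measure ?M (Z M) \<le> window_weight C g ^ M"
      "{\<omega> \<in> space ?M. \<exists>x\<in>cell (real L ^ n) X. \<forall>i<M. bad_window C g (n + 2 * g * i) x \<omega>} \<subseteq> Z M" for M
      by simp_all
    let ?Z = "\<Inter>M. Z M"
    have meas: "?Z \<in> sets ?M" using Z(1) by (intro sets.countable_INT) auto
    have "0 \<le> window_weight C g" using \<delta>_nonneg by (simp add: window_weight_def)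
    then have "(\<lambda>M. window_weight C g ^ M) \<longlonglongrightarrow> 0"
      using assms(5) by (intro LIMSEQ_power_zero) simp
    moreover have "measure ?M ?Z \<le> window_weight C g ^ M" for M
      using finite_measure_mono[of ?Z "Z M"] Z(1,2) by (meson INT_lower UNIV_I order.trans)
    ultimately have "measure ?M ?Z \<le> 0"
      by (intro LIMSEQ_le_const) auto
    then have "measure ?M ?Z = 0"
      by (simp add: measure_le_0_iff)
    then have "?Z \<in> null_sets ?M"
      using meas by (intro null_setsI) (simp_all add: emeasure_eq_measure)
    then show ?thesis
      by (rule AE_I') (use Z(3) in blast)
  qed
  then show ?thesis by (simp add: AE_all_countable)
qed

end

section \<open>Unrectifiability\<close>

text \<open>Under the third assumption the two sides differ by a factor that is a power of some x >
  1, so a large q beats the constants of the curve. The second conclusion lets the same q make the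
  window weight smaller than 1.\<close>

lemma exists_window_length:
  assumes "0 < \<alpha>" "L \<ge> 1" "real L powr (2 / \<alpha>) < real (L * (L + 1))" "0 < h" "0 < c"
  obtains q where "4 * (2 * h * real L ^ (2 * q) / c) powr (1 / \<alpha>) \<le> real (L * (L + 1)) ^ q"
    and "real w * (1 / 2) ^ q < 1"
proof -
  define x where "x = real (L * (L + 1)) / real L powr (2 / \<alpha>)"
  have Lp: "real L powr (2 / \<alpha>) > 0" using assms(2) by simp
  then have "x > 1" using assms(3) by (simp add: x_def)
  obtain q1 where q1: "4 * (2 * h / c) powr (1 / \<alpha>) < x ^ q1"
    using real_arch_pow[OF \<open>x > 1\<close>] by blast
  obtain q2 where q2: "real w < 2 ^ q2"
    using real_arch_pow[of 2 "real w"] by auto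
  define q where "q = max q1 q2"
  have "4 * (2 * h / c) powr (1 / \<alpha>) \<le> x ^ q"
  proof -
    have "x ^ q1 \<le> x ^ q" using \<open>x > 1\<close> by (intro power_increasing) (auto simp: q_def)
    then show ?thesis using q1 by linarith
  qed
  then have "4 * (2 * h / c) powr (1 / \<alpha>) * (real L powr (2 / \<alpha>)) ^ q \<le> real (L * (L + 1)) ^ q"
    using Lp by (simp add: x_def power_divide pos_le_divide_eq)
  moreover have "(2 * h * real L ^ (2 * q) / c) powr (1 / \<alpha>) = (2 * h / c) powr (1 / \<alpha>) * (real L powr (2 / \<alpha>)) ^ q"
  proof -
    have "(2 * h * real L ^ (2 * q) / c) powr (1 / \<alpha>) = ((2 * h / c) * real L ^ (2 * q)) powr (1 / \<alpha>)"
      by simp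
    also have "\<dots> = (2 * h / c) powr (1 / \<alpha>) * (real L ^ (2 * q)) powr (1 / \<alpha>)"
      using assms by (subst powr_mult) auto
    also have "(real L ^ (2 * q)) powr (1 / \<alpha>) = (real L powr (2 / \<alpha>)) ^ q"
      using assms(2) by (simp add: powr_powr powr_power flip: powr_realpow)
    finally show ?thesis .
  qed
  moreover have "real w * (1 / 2) ^ q < 1"
  proof -
    have "(2::real) ^ q2 \<le> 2 ^ q" by (simp add: q_def)
    then have "real w < 2 ^ q" using q2 by linarith
    then show ?thesis by (simp add: power_one_over)
  qed
  ultimately show thesis using that[of q] by simp
qed

lemma continuous_on_Hoelder_curve:
  assumes "0 < \<alpha>" "Hoelder_curve \<alpha> I \<gamma>"
  shows "continuous_on I \<gamma>"
  unfolding continuous_on_def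
proof
  fix t assume "t \<in> I"
  then obtain H where H: "Hoelder_at H \<alpha> I \<gamma> t" using assms(2) unfolding Hoelder_curve_def by blast
  have "((\<lambda>x. H * \<bar>t - x\<bar> powr \<alpha>) \<longlongrightarrow> H * \<bar>t - t\<bar> powr \<alpha>) (at t within I)"
    using assms(1) by (intro tendsto_intros tendsto_powr2) auto
  then have "((\<lambda>x. H * \<bar>t - x\<bar> powr \<alpha>) \<longlongrightarrow> 0) (at t within I)"
    by simp
  moreover have "eventually (\<lambda>x. norm (\<gamma> x - \<gamma> t) \<le> H * \<bar>t - x\<bar> powr \<alpha>) (at t within I)"
    using H unfolding Hoelder_at_def eventually_at_filter by (auto simp: norm_minus_commute intro!: always_eventually)
  ultimately have "((\<lambda>x. \<gamma> x - \<gamma> t) \<longlongrightarrow> 0) (at t within I)"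
    by (rule Lim_null_comparison[rotated])
  then show "(\<gamma> \<longlongrightarrow> \<gamma> t) (at t within I)"
    by (rule LIM_zero_cancel)
qed

text \<open>A countable decomposition makes the pointwise constants uniform: \<open>A h\<close>
  bounds the Hoelder constant, and its points either spread less than every 1/(k+1) at some scale
  (\<open>Z h\<close>) or at least some 1/(k+1) at all scales (\<open>B h k\<close>). Slow points
  have a null image; \<open>B h k\<close> is porous, hence negligible.\<close>

lemma Hoelder_curve_image_null:
  fixes \<gamma> :: "real \<Rightarrow> 'a::real_inner"
  defines "r \<equiv> \<lambda>L :: nat. \<lambda>n. 1 / real L ^ n"
  assumes \<alpha>: "0 < \<alpha>" "\<alpha> \<le> 1" and "a \<le> b" and curve: "Hoelder_curve \<alpha> {a..b} \<gamma>"
    and L: "L \<ge> 2" "real L powr (2 / \<alpha>) < real (L * (L + 1))"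
    and \<eta>: "0 < \<eta>" "\<eta> \<le> 1" "real L * \<eta>\<^sup>2 \<ge> 3"
    and no_windows: "\<And>C q n x. real (w C) * (1 / 2) ^ q < 1 \<Longrightarrow>
      \<exists>i. \<not> (\<exists>y. norm (y - x) \<le> real C * r L (n + 2 * q * i) \<and>
        bad_chain (r L) (flat_near (r L) \<eta> E) (2 * q) (Suc q) (n + 2 * q * i) y)"
  shows "hausdorff_measure (1 / \<alpha>) (E \<inter> \<gamma> ` {a..b}) = 0"
proof -
  \<comment> \<open>Dyadic intervals may stick out of [a,b]. Clamping extends the curve to the line
    and does not increase distances from points of [a,b], so the Hoelder bounds survive.\<close>
  define clamp where "clamp x = max a (min b x)" for x
  define g where "g x = \<gamma> (clamp x)" for x
  have clamp: "clamp x \<in> {a..b}" "t \<in> {a..b} \<Longrightarrow> clamp t = t" "t \<in> {a..b} \<Longrightarrow> \<bar>t - clamp x\<bar> \<le> \<bar>t - x\<bar>" for x t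
    using \<open>a \<le> b\<close> by (auto simp: clamp_def)
  have "continuous_on UNIV clamp"
    unfolding clamp_def by (intro continuous_intros)
  then have cont: "continuous_on UNIV g"
    unfolding g_def using clamp(1)
    by (intro continuous_on_compose2[OF continuous_on_Hoelder_curve[OF \<alpha>(1) curve]]) auto
  define D where "D j t = dyadic j \<lfloor>t * 2 ^ j\<rfloor>" for j and t :: real
  define A where "A h = {t \<in> {a..b}. \<gamma> t \<in> E \<and> (\<forall>x. norm (g t - g x) \<le> real (Suc h) * \<bar>t - x\<bar> powr \<alpha>)}" for h
  define Z where "Z h = {t \<in> A h. \<forall>k. \<exists>j. \<forall>u\<in>D j t. \<forall>v\<in>D j t. norm (g u - g v) \<le> 1 / real (Suc k) * (1 / 2 ^ j) powr \<alpha>}" for h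
  define B where "B h k = {t \<in> A h. \<forall>j. \<exists>u\<in>D j t. \<exists>v\<in>D j t. norm (g u - g v) \<ge> 1 / real (Suc k) * (1 / 2 ^ j) powr \<alpha>}" for h k
  have A_cover: "\<exists>h. t \<in> A h" if "t \<in> {a..b}" "\<gamma> t \<in> E" for t
  proof -
    obtain H where H: "Hoelder_at H \<alpha> {a..b} \<gamma> t" "H \<ge> 0"
      using curve \<open>t \<in> {a..b}\<close> unfolding Hoelder_curve_def by blast
    obtain h where h: "H \<le> real h" using real_arch_simple by blast
    have "norm (g t - g x) \<le> real (Suc h) * \<bar>t - x\<bar> powr \<alpha>" for x
    proof -
      have "norm (g t - g x) \<le> H * \<bar>t - clamp x\<bar> powr \<alpha>"
        using H(1) clamp(1)[of x] clamp(2)[OF that(1)] unfolding Hoelder_at_def g_def by simp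
      also have "\<dots> \<le> real (Suc h) * \<bar>t - x\<bar> powr \<alpha>"
        using h H(2) \<alpha> clamp(3)[OF that(1), of x] by (intro mult_mono powr_mono2) auto
      finally show ?thesis .
    qed
    then show ?thesis using that unfolding A_def by blast
  qed
  have Z_null: "hausdorff_null (1 / \<alpha>) (g ` Z h)" for h
    by (rule hausdorff_null_slow[OF \<alpha>(1) _ \<open>a \<le> b\<close>]) (auto simp: Z_def A_def D_def)
  have B_null: "hausdorff_null (1 / \<alpha>) (g ` B h k)" for h k
  proof -
    define H where "H = real (Suc h)"
    define c where "c = 1 / real (Suc k)"
    have pos: "H > 0" "c > 0" by (simp_all add: H_def c_def)
    have hol: "norm (g t - g x) \<le> H * \<bar>t - x\<bar> powr \<alpha>" if "t \<in> B h k" for t x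
      using that unfolding B_def A_def H_def by blast
    have BE: "g t \<in> E" if "t \<in> B h k" for t
      using that clamp(2) unfolding B_def A_def g_def by simp
    obtain C where C: "2 * H / c \<le> real C" using real_arch_simple by blast
    have "L \<ge> 1" using L(1) by simp
    obtain q where q: "4 * (2 * H * real L ^ (2 * q) / c) powr (1 / \<alpha>) \<le> real (L * (L + 1)) ^ q"
      and wq: "real (w C) * (1 / 2) ^ q < 1"
      using exists_window_length[OF \<alpha>(1) \<open>L \<ge> 1\<close> L(2) pos] by blast
    define P where "P = (c * \<eta> / (2 * H * real L ^ (2 * q))) powr (1 / \<alpha>)"
    have "P > 0" using pos \<eta> L by (simp add: P_def)
    then obtain p where "(1 / 2) ^ p < P / 4"
      using real_arch_pow_inv[of "P / 4" "1/2"] by auto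
    then have p: "4 * (1 / 2 ^ p) \<le> P" by (simp add: power_one_over)
    have r: "r L n > 0" "real L * r L (Suc n) = r L n" for n
      using L by (simp_all add: r_def)
    have "negligible (B h k)"
    proof (rule porous_negligible)
      show "bounded (B h k)"
        by (rule bounded_subset[OF bounded_closed_interval[of a b]]) (auto simp: B_def A_def)
      fix t J assume t: "t \<in> B h k"
      show "\<exists>j\<ge>J. \<exists>i. dyadic (j + p) i \<subseteq> dyadic j \<lfloor>t * 2 ^ j\<rfloor> \<and> dyadic (j + p) i \<inter> B h k = {}"
      proof (rule ccontr)
        \<comment> \<open>Without a hole at any scale beyond J, \<open>bad_chain_at_scale\<close>
          applies near \<open>g t\<close> at every level from some n1 on, hence in all windows that
          start there.\<close>
        assume *: "\<not> ?thesis"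
        have "(\<lambda>n. (1 / real L) ^ n) \<longlonglongrightarrow> 0"
          using L by (intro LIMSEQ_power_zero) simp
        then have "eventually (\<lambda>n. (1 / real L) ^ n < c * (1 / 2 ^ J) powr \<alpha>) sequentially"
          using pos by (intro order_tendstoD(2)) auto
        then obtain n1 where n1: "\<And>n. n \<ge> n1 \<Longrightarrow> r L n \<le> c * (1 / 2 ^ J) powr \<alpha>"
          unfolding eventually_sequentially r_def by (auto simp: power_one_over intro: less_imp_le)
        have "\<exists>y. norm (y - g t) \<le> real C * r L n \<and> bad_chain (r L) (flat_near (r L) \<eta> E) (2 * q) (Suc q) n y"
          if "n \<ge> n1" for n
        proof -
          obtain j where j: "j \<ge> J" "r L n \<le> c * (1 / 2 ^ j) powr \<alpha>" "c * (1 / 2 ^ Suc j) powr \<alpha> < r L n"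
            using exists_dyadic_scale[OF \<alpha>(1) pos(2) r(1) n1[OF \<open>n \<ge> n1\<close>]] by blast
          have lucky: "dyadic (j + p) i \<inter> B h k \<noteq> {}" if "dyadic (j + p) i \<subseteq> dyadic j \<lfloor>t * 2 ^ j\<rfloor>" for i
            using * j(1) that by blast
          have spread: "\<exists>u\<in>dyadic j \<lfloor>t * 2 ^ j\<rfloor>. \<exists>v\<in>dyadic j \<lfloor>t * 2 ^ j\<rfloor>. norm (g u - g v) \<ge> c * (1 / 2 ^ j) powr \<alpha>"
            using t unfolding B_def D_def c_def by blast
          have "\<exists>y. norm (y - g t) \<le> 2 * H / c * r L n \<and> bad_chain (r L) (flat_near (r L) \<eta> E) (2 * q) (Suc q) n y"
            by (rule bad_chain_at_scale[OF \<alpha> cont hol BE pos r \<open>L \<ge> 1\<close> \<eta> q p[unfolded P_def] t lucky spread j(2,3)])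
          then obtain y where y: "norm (y - g t) \<le> 2 * H / c * r L n"
            "bad_chain (r L) (flat_near (r L) \<eta> E) (2 * q) (Suc q) n y" by blast
          have "norm (y - g t) \<le> real C * r L n"
            using y(1) mult_right_mono[OF C, of "r L n"] r(1)[of n] by linarith
          with y(2) show ?thesis by blast
        qed
        then have "\<exists>y. norm (y - g t) \<le> real C * r L (n1 + 2 * q * i) \<and>
            bad_chain (r L) (flat_near (r L) \<eta> E) (2 * q) (Suc q) (n1 + 2 * q * i) y" for i
          by simp
        then show False using no_windows[OF wq, of "g t" n1] by blast
      qed
    qed
    with hol show ?thesis
      by (rule hausdorff_null_image_negligible[OF \<alpha>(1) pos(1)])
  qed
  have "E \<inter> \<gamma> ` {a..b} \<subseteq> (\<Union>h. g ` Z h) \<union> (\<Union>h. \<Union>k. g ` B h k)"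
  proof
    fix x assume "x \<in> E \<inter> \<gamma> ` {a..b}"
    then obtain t where t: "t \<in> {a..b}" "x = \<gamma> t" "\<gamma> t \<in> E" by blast
    then obtain h where h: "t \<in> A h" using A_cover by blast
    have x: "x = g t" using t clamp(2) by (simp add: g_def)
    show "x \<in> (\<Union>h. g ` Z h) \<union> (\<Union>h. \<Union>k. g ` B h k)"
    proof (cases "t \<in> Z h")
      case True
      then show ?thesis using x by blast
    next
      case False
      then obtain k where "\<forall>j. \<exists>u\<in>D j t. \<exists>v\<in>D j t. \<not> norm (g u - g v) \<le> 1 / real (Suc k) * (1 / 2 ^ j) powr \<alpha>"
        using h unfolding Z_def by blast
      then have "t \<in> B h k"
        using h unfolding B_def not_le mem_Collect_eq by (blast intro: less_imp_le)
      then show ?thesis using x by blast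
    qed
  qed
  moreover have "hausdorff_null (1 / \<alpha>) ((\<Union>h. g ` Z h) \<union> (\<Union>h. \<Union>k. g ` B h k))"
  proof -
    have "hausdorff_null (1 / \<alpha>) (\<Union>n::nat. if n = 0 then (\<Union>h. g ` Z h) else (\<Union>h. \<Union>k. g ` B h k))"
      by (rule hausdorff_null_UN) (auto intro!: hausdorff_null_UN Z_null B_null)
    then show ?thesis by (rule hausdorff_null_subset) (auto split: if_splits)
  qed
  ultimately show ?thesis
    using \<alpha> by (intro hausdorff_measure_eq_0I) (auto intro: hausdorff_null_subset)
qed

text \<open>With R = N^m the left side is a polynomial in R times \<sigma>^K, and K grows in
  proportion to R, so the exponential wins.\<close>

lemma exists_coarse_level:
  fixes \<sigma> :: real and N D :: nat
  assumes \<sigma>: "0 \<le> \<sigma>" "\<sigma> < 1" and "D \<ge> 1" "N \<ge> 2"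
  shows "\<exists>m K. K = N ^ m div (8 * D) \<and> K \<ge> 1 \<and> N ^ m \<ge> 3 \<and>
    4 * real ((3 * N ^ (3 * m)) * (3 * N ^ (3 * m)) * (N ^ (3 * m) * N ^ (3 * m))) ^ D
      * (real ((3 * (N ^ m)\<^sup>2) ^ D) * \<sigma> ^ K) \<le> 1 / 2"
proof -
  \<comment> \<open>The polynomial has degree 14 D: 12 from the four factors L = R^3 and 2 from the
    candidate segments. Taking this root makes the bound a 14 D-th power, and K \<tau>^K tending to
    0 suffices.\<close>
  define \<tau> where "\<tau> = root (14 * D) \<sigma>"
  have \<tau>: "0 \<le> \<tau>" "\<tau> < 1" "\<tau> ^ (14 * D) = \<sigma>"
    using assms by (simp_all add: \<tau>_def)
  have "(\<lambda>n. real n * \<tau> ^ n) \<longlonglongrightarrow> 0"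
    using powser_times_n_limit_0[of \<tau>] \<tau> by simp
  moreover have "(\<lambda>n. \<tau> ^ n) \<longlonglongrightarrow> 0"
    using \<tau> by (intro LIMSEQ_power_zero) simp
  ultimately have lim: "(\<lambda>n. real n * \<tau> ^ n + \<tau> ^ n) \<longlonglongrightarrow> 0 + 0"
    by (rule tendsto_add)
  have lim': "(\<lambda>n. 4 * 27 ^ D * (8 * real D * (real n * \<tau> ^ n + \<tau> ^ n)) ^ (14 * D)) \<longlonglongrightarrow> 4 * 27 ^ D * (8 * real D * (0 + 0)) ^ (14 * D)"
    by (rule tendsto_mult[OF tendsto_const tendsto_power[OF tendsto_mult[OF tendsto_const lim]]])
  have "eventually (\<lambda>n. 4 * 27 ^ D * (8 * real D * (real n * \<tau> ^ n + \<tau> ^ n)) ^ (14 * D) < 1 / 2) sequentially"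
    by (rule order_tendstoD(2)[OF lim']) (use \<open>D \<ge> 1\<close> in \<open>simp add: power_0_left\<close>)
  then obtain n0 where n0: "\<And>n. n \<ge> n0 \<Longrightarrow> 4 * 27 ^ D * (8 * real D * (real n * \<tau> ^ n + \<tau> ^ n)) ^ (14 * D) < 1 / 2"
    unfolding eventually_sequentially by blast
  define k where "k = max n0 3"
  \<comment> \<open>From m < 2^m \<le> N^m follows 8 D k \<le> N^m and thus K \<ge> k; the 3 in
    \<open>k\<close> also gives N^m \<ge> 3.\<close>
  define m where "m = 8 * D * k"
  have m: "8 * D * k \<le> N ^ m"
  proof -
    have "m < 2 ^ m" by (rule less_exp)
    also have "\<dots> \<le> N ^ m" using \<open>N \<ge> 2\<close> by (rule power_mono) simp
    finally show ?thesis by (simp add: m_def)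
  qed
  define K where "K = N ^ m div (8 * D)"
  have "k \<le> K"
    unfolding K_def using div_le_mono[OF m, of "8 * D"] \<open>D \<ge> 1\<close> by simp
  have "N ^ m < 8 * D * (K + 1)"
    using dividend_less_times_div[of "8 * D" "N ^ m"] \<open>D \<ge> 1\<close>
    unfolding K_def distrib_left mult_1_right by linarith
  then have R: "real N ^ m \<le> 8 * real D * (real K + 1)"
  proof -
    have "real (N ^ m) \<le> real (8 * D * (K + 1))"
      using \<open>N ^ m < 8 * D * (K + 1)\<close> by (simp only: of_nat_le_iff less_imp_le)
    then show ?thesis by (simp add: distrib_left)
  qed
  define R where "R = real N ^ m"
  have "4 * real ((3 * N ^ (3 * m)) * (3 * N ^ (3 * m)) * (N ^ (3 * m) * N ^ (3 * m))) ^ D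
      * (real ((3 * (N ^ m)\<^sup>2) ^ D) * \<sigma> ^ K) = 4 * 27 ^ D * (R ^ (14 * D) * \<sigma> ^ K)"
  proof -
    have "real N ^ (3 * m) = R ^ 3" by (simp add: R_def mult.commute flip: power_mult)
    then have e1: "real ((3 * N ^ (3 * m)) * (3 * N ^ (3 * m)) * (N ^ (3 * m) * N ^ (3 * m))) = 9 * R ^ 12"
      by (simp add: power_numeral_reduce mult_ac)
    have e2: "real ((3 * (N ^ m)\<^sup>2) ^ D) = (3 * R ^ 2) ^ D" by (simp add: R_def)
    have e3: "(9 * R ^ 12) ^ D * (3 * R ^ 2) ^ D = 27 ^ D * R ^ (14 * D)"
    proof -
      have "(9 * R ^ 12) * (3 * R ^ 2) = 27 * R ^ 14" by (simp flip: power_add)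
      then have "((9 * R ^ 12) * (3 * R ^ 2)) ^ D = (27 * R ^ 14) ^ D" by (rule arg_cong)
      then show ?thesis by (simp only: power_mult_distrib power_mult)
    qed
    have regroup: "4 * x * (y * z) = 4 * u * (v * z)" if "x * y = u * v" for x y z u v :: real
    proof -
      have "4 * x * (y * z) = 4 * (x * y) * z" by (simp only: mult.assoc)
      also have "\<dots> = 4 * u * (v * z)" by (simp only: that mult.assoc)
      finally show ?thesis .
    qed
    show ?thesis unfolding e1 e2 by (rule regroup[OF e3])
  qed
  also have "\<dots> \<le> 4 * 27 ^ D * ((8 * real D * (real K + 1)) ^ (14 * D) * \<sigma> ^ K)"
    using R \<sigma> unfolding R_def by (intro mult_left_mono mult_right_mono power_mono) auto
  also have "(8 * real D * (real K + 1)) ^ (14 * D) * \<sigma> ^ K = (8 * real D * (real K * \<tau> ^ K + \<tau> ^ K)) ^ (14 * D)"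
  proof -
    have "\<sigma> ^ K = (\<tau> ^ K) ^ (14 * D)" by (simp add: \<tau>(3)[symmetric] mult.commute flip: power_mult)
    then show ?thesis by (simp add: distrib_right distrib_left mult.assoc flip: power_mult_distrib)
  qed
  also have "4 * 27 ^ D * \<dots> < 1 / 2"
    by (rule n0) (use \<open>k \<le> K\<close> in \<open>simp add: k_def\<close>)
  finally have "4 * real ((3 * N ^ (3 * m)) * (3 * N ^ (3 * m)) * (N ^ (3 * m) * N ^ (3 * m))) ^ D
      * (real ((3 * (N ^ m)\<^sup>2) ^ D) * \<sigma> ^ K) \<le> 1 / 2" by simp
  moreover have "K \<ge> 1" using \<open>k \<le> K\<close> by (simp add: k_def)
  moreover have "N ^ m \<ge> 3"
  proof -
    have "3 \<le> k" by (simp add: k_def)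
    also have "k \<le> 8 * D * k" using \<open>D \<ge> 1\<close> by simp
    finally show ?thesis using m by linarith
  qed
  ultimately show ?thesis using K_def by blast
qed

lemma bad_chain_mono:
  assumes "\<And>n y. bad n y \<Longrightarrow> bad' n y"
  shows "bad_chain r bad h b n y \<Longrightarrow> bad_chain r bad' h b n y"
proof (induction h arbitrary: b n y)
  case (Suc h)
  then show ?case using assms by (simp only: bad_chain.simps) blast
qed simp

text \<open>For \<eta> = 1/R the tolerance is exactly twice the side of the tested cubes, and the
  percolation set lies in the union of the chosen cubes of that level.\<close>

lemma flat_near_imp_flat_at:
  assumes "flat_near (\<lambda>n. 1 / real (N ^ (3 * m)) ^ n) (1 / real (N ^ m)) (percolation_set N \<omega>) n y"
  shows "flat_at N m \<omega> n y"
proof -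
  have "2 * (1 / real (N ^ m)) * (1 / real (N ^ (3 * m)) ^ n) = 2 / real N ^ (3 * m * n + m)"
    by (simp add: power_add power_mult)
  moreover have "percolation_set N \<omega> \<subseteq> \<Union>(chosen_cubes N \<omega> (3 * m * n + m))"
    unfolding percolation_set_def by blast
  ultimately show ?thesis
    using assms unfolding flat_near_def flat_at_def by (metis subsetD)
qed

theorem theorem6p13:
  fixes p :: real and N :: nat
  assumes "CARD('d::finite) \<ge> 2" and "N \<ge> 2" and "0 \<le> p" and "p < 1"
  shows "\<exists>\<alpha>\<^sub>0<1. AE \<omega> in percolation_space p N.
           \<forall>\<alpha>\<in>{0<..1}. \<alpha>\<^sub>0 < \<alpha> \<longrightarrow>
             purely_unrectifiable \<alpha> (percolation_set N \<omega> :: (real ^ 'd) set)"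
proof -
  define \<kappa> :: nat where "\<kappa> = 9 ^ CARD('d)"
  \<comment> \<open>A block has at most \<kappa> cubes, so \<sigma> bounds the probability that it
    contains a chosen one; it is below 1 because p is.\<close>
  define \<sigma> where "\<sigma> = 1 - (1 - p) ^ \<kappa>"
  have \<sigma>: "0 \<le> \<sigma>" "\<sigma> < 1"
    using assms by (simp_all add: \<sigma>_def power_le_one)
  obtain m K where K: "K = N ^ m div (8 * CARD('d))" "K \<ge> 1" and R: "N ^ m \<ge> 3"
    and small: "4 * real ((3 * N ^ (3 * m)) * (3 * N ^ (3 * m)) * (N ^ (3 * m) * N ^ (3 * m))) ^ CARD('d)
      * (real ((3 * (N ^ m)\<^sup>2) ^ CARD('d)) * \<sigma> ^ K) \<le> 1 / 2"
    using exists_coarse_level[OF \<sigma>, of "CARD('d)" N] assms by auto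
  define L where "L = N ^ (3 * m)"
  define \<delta> where "\<delta> = real ((3 * (N ^ m)\<^sup>2) ^ CARD('d)) * \<sigma> ^ K"
  have "L \<ge> N ^ m"
    unfolding L_def using assms by (intro power_increasing) auto
  then have "L \<ge> 2" using R by simp
  have "m \<noteq> 0"
    using R by (cases m) auto
  interpret bad_cells "\<lambda>n. grid_cubes N (3 * m * n + m) :: (real ^ 'd) set set" \<kappa> \<sigma> \<delta> L "flat_at N m"
  proof
    show "0 \<le> \<delta>" using \<sigma> by (simp add: \<delta>_def)
    show "grid_cubes N (3 * m * n + m) \<inter> (grid_cubes N (3 * m * n' + m) :: (real ^ 'd) set set) = {}" if "n \<noteq> n'" for n n'
      by (rule grid_cubes_levels_disjoint) (use assms that \<open>m \<noteq> 0\<close> in auto)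
    show "coverable (\<lambda>n. grid_cubes N (3 * m * n + m) :: (real ^ 'd) set set) \<kappa> \<sigma> {n}
        (\<lambda>\<omega>. \<exists>y\<in>cell (real L ^ n) Y. flat_at N m \<omega> n y) \<delta>" for n Y
      unfolding \<kappa>_def L_def \<delta>_def by (rule flat_coverable[OF K(1) _ K(2) \<sigma>(1)]) (use assms in simp)
  qed (use \<sigma> \<open>L \<ge> 2\<close> in auto)
  define weight where "weight C = (2 * C + 1) ^ CARD('d)" for C :: nat
  have "\<delta> \<le> 1"
  proof -
    have "1 * \<delta> \<le> 4 * real ((3 * L) * (3 * L) * (L * L)) ^ CARD('d) * \<delta>"
    proof (rule mult_right_mono)
      have "(1::nat) \<le> (3 * L) * (3 * L) * (L * L)" using \<open>L \<ge> 2\<close> by simp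
      then have "1 \<le> real ((3 * L) * (3 * L) * (L * L))" by (subst of_nat_1[symmetric]) (simp only: of_nat_le_iff)
      then have "1 \<le> real ((3 * L) * (3 * L) * (L * L)) ^ CARD('d)" by (rule one_le_power)
      then show "1 \<le> 4 * real ((3 * L) * (3 * L) * (L * L)) ^ CARD('d)" by linarith
    qed (rule \<delta>_nonneg)
    also have "\<dots> \<le> 1 / 2" using small by (simp only: L_def \<delta>_def)
    finally show ?thesis by simp
  qed
  have weight: "window_weight C q < 1" if "real (weight C) * (1 / 2) ^ q < 1" for C q
    using window_weight_le[of C q] small that \<open>\<delta> \<le> 1\<close> unfolding L_def \<delta>_def weight_def by linarith
  \<comment> \<open>The solution of L^(2/\<alpha>) = L (L+1), below 1 because L^2 < L (L+1).\<close>
  define \<alpha>\<^sub>0 where "\<alpha>\<^sub>0 = 2 * ln (real L) / ln (real (L * (L + 1)))"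
  have lnL: "0 < ln (real L)" "0 < ln (real (L * (L + 1)))"
  proof -
    show "0 < ln (real L)" using \<open>L \<ge> 2\<close> by simp
    have "2 * 1 \<le> L * (L + 1)" using \<open>L \<ge> 2\<close> by (intro mult_le_mono) auto
    then have "1 < real (L * (L + 1))" by linarith
    then show "0 < ln (real (L * (L + 1)))" by (rule ln_gt_zero)
  qed
  have "\<alpha>\<^sub>0 < 1"
  proof -
    have "2 * ln (real L) = ln (real (L * L))" using \<open>L \<ge> 2\<close> by (simp add: ln_mult)
    also have "\<dots> < ln (real (L * (L + 1)))"
      using \<open>L \<ge> 2\<close> by (subst ln_less_cancel_iff) (auto simp del: of_nat_mult of_nat_add)
    finally show ?thesis using lnL by (simp add: \<alpha>\<^sub>0_def)
  qed
  have "AE \<omega> in PiM (\<Union>n. grid_cubes N n :: (real ^ 'd) set set) (\<lambda>_. measure_pmf (bernoulli_pmf p)).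
      \<forall>C q n. window_weight C q < 1 \<longrightarrow> (\<forall>X. \<not> (\<exists>x\<in>cell (real L ^ n) X. \<forall>i. bad_window C q (n + 2 * q * i) x \<omega>))"
    unfolding AE_all_countable
  proof (intro allI)
    fix C q n
    show "AE \<omega> in PiM (\<Union>n. grid_cubes N n :: (real ^ 'd) set set) (\<lambda>_. measure_pmf (bernoulli_pmf p)).
      window_weight C q < 1 \<longrightarrow> (\<forall>X. \<not> (\<exists>x\<in>cell (real L ^ n) X. \<forall>i. bad_window C q (n + 2 * q * i) x \<omega>))"
      using AE_no_bad_windows[of p "\<Union>n. grid_cubes N n" C q n] assms(3,4) \<sigma>_def
      by (cases "window_weight C q < 1") auto
  qed
  then have "AE \<omega> in percolation_space p N. \<forall>C q n. window_weight C q < 1 \<longrightarrow>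
      (\<forall>X. \<not> (\<exists>x\<in>cell (real L ^ n) (X :: 'd \<Rightarrow> int). \<forall>i. bad_window C q (n + 2 * q * i) x \<omega>))"
    unfolding percolation_space_def by (rule AE_completion)
  then have "AE \<omega> in percolation_space p N. \<forall>\<alpha>\<in>{0<..1}. \<alpha>\<^sub>0 < \<alpha> \<longrightarrow>
      purely_unrectifiable \<alpha> (percolation_set N \<omega> :: (real ^ 'd) set)"
  proof (eventually_elim, intro ballI impI)
    fix \<omega> :: "(real ^ 'd) set \<Rightarrow> bool" and \<alpha> :: real
    assume no: "\<forall>C q n. window_weight C q < 1 \<longrightarrow>
      (\<forall>X. \<not> (\<exists>x\<in>cell (real L ^ n) (X :: 'd \<Rightarrow> int). \<forall>i. bad_window C q (n + 2 * q * i) x \<omega>))"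
    assume "\<alpha> \<in> {0<..1}" "\<alpha>\<^sub>0 < \<alpha>"
    then have \<alpha>: "0 < \<alpha>" "\<alpha> \<le> 1" by auto
    have "real L powr (2 / \<alpha>) < real (L * (L + 1))"
    proof -
      have "2 * ln (real L) < \<alpha> * ln (real (L * (L + 1)))"
        using \<open>\<alpha>\<^sub>0 < \<alpha>\<close> lnL by (simp add: \<alpha>\<^sub>0_def pos_divide_less_eq)
      then have "2 / \<alpha> * ln (real L) < ln (real (L * (L + 1)))"
        using \<alpha>(1) by (simp add: pos_divide_less_eq mult.commute)
      moreover have "ln (real L powr (2 / \<alpha>)) = 2 / \<alpha> * ln (real L)"
        using \<open>L \<ge> 2\<close> by (simp add: ln_powr)
      ultimately have "ln (real L powr (2 / \<alpha>)) < ln (real (L * (L + 1)))" by linarith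
      then show ?thesis
        using \<open>L \<ge> 2\<close> by (subst (asm) ln_less_cancel_iff) (auto simp del: of_nat_mult)
    qed
    have \<eta>: "0 < 1 / real (N ^ m)" "1 / real (N ^ m) \<le> 1" "real L * (1 / real (N ^ m))\<^sup>2 \<ge> 3"
    proof -
      have ge: "real (N ^ m) \<ge> 3" using of_nat_mono[OF R, where 'a = real] by simp
      have "3 * m = m + (m + m)" by simp
      then have L_eq: "real L = real (N ^ m) * (real (N ^ m))\<^sup>2"
        by (simp only: L_def power2_eq_square of_nat_power of_nat_mult power_add)
      have "0 < 1 / x \<and> 1 / x \<le> 1 \<and> x * x\<^sup>2 * (1 / x)\<^sup>2 \<ge> 3" if "x \<ge> 3" for x :: real
        using that by (auto simp: power_divide)
      from this[OF ge] show "0 < 1 / real (N ^ m)" "1 / real (N ^ m) \<le> 1" "real L * (1 / real (N ^ m))\<^sup>2 \<ge> 3"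
        unfolding L_eq by (simp_all only:)
    qed
    have mono: "bad_chain scale (flat_at N m \<omega>) h b n y"
      if "bad_chain scale (flat_near scale (1 / real (N ^ m)) (percolation_set N \<omega>)) h b n y" for h b n y
      using _ that by (rule bad_chain_mono) (rule flat_near_imp_flat_at, simp only: L_def)
    have "hausdorff_measure (1 / \<alpha>) (percolation_set N \<omega> \<inter> \<gamma> ` {a..b}) = 0"
      if "a \<le> b" "Hoelder_curve \<alpha> {a..b} \<gamma>" for a b and \<gamma> :: "real \<Rightarrow> real ^ 'd"
    proof (rule Hoelder_curve_image_null[OF \<alpha> that \<open>L \<ge> 2\<close> \<open>real L powr (2 / \<alpha>) < real (L * (L + 1))\<close> \<eta>])
      fix C q n and x :: "real ^ 'd"
      assume "real (weight C) * (1 / 2) ^ q < 1"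
      then have "\<not> (\<forall>i. bad_window C q (n + 2 * q * i) x \<omega>)"
        using no weight mem_cell_floor[of x "real L ^ n"] by blast
      then obtain i where "\<not> bad_window C q (n + 2 * q * i) x \<omega>" by blast
      then have "\<not> (\<exists>y. norm (y - x) \<le> real C * (1 / real L ^ (n + 2 * q * i)) \<and>
          bad_chain (\<lambda>n. 1 / real L ^ n) (flat_near (\<lambda>n. 1 / real L ^ n) (1 / real (N ^ m)) (percolation_set N \<omega>)) (2 * q) (Suc q) (n + 2 * q * i) y)"
        using mono unfolding bad_window_def by blast
      then show "\<exists>i. \<not> (\<exists>y. norm (y - x) \<le> real C * (1 / real L ^ (n + 2 * q * i)) \<and>
          bad_chain (\<lambda>n. 1 / real L ^ n) (flat_near (\<lambda>n. 1 / real L ^ n) (1 / real (N ^ m)) (percolation_set N \<omega>)) (2 * q) (Suc q) (n + 2 * q * i) y)"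
        by blast
    qed
    then show "purely_unrectifiable \<alpha> (percolation_set N \<omega> :: (real ^ 'd) set)"
      unfolding purely_unrectifiable_def by blast
  qed
  then show ?thesis using \<open>\<alpha>\<^sub>0 < 1\<close> by blast
qed

end
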